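(* Let $\mathcal B$ be a Krull–Schmidt exact category with enough projectives and enough injectives, and let $(\mathcal U,\mathcal V)$ be a cotorsion pair on $\mathcal B$. Then its heart $\underline{\mathcal H}=(\mathcal B^+\cap\mathcal B^-)/(\mathcal U\cap\mathcal V)$ is an abelian category.
   Context: Exact category is meant in the sense of Quillen (the class of short exact sequences is closed under isomorphisms, direct sums and direct summands); $X\rightarrowtail Y\twoheadrightarrow Z$ denotes a short exact sequence of the exact structure. $\mathrm{Ext}^1_{\mathcal B}(\mathcal U,\mathcal V)=0$ means $\mathrm{Ext}^1_{\mathcal B}(U,V)=0$ for all $U\in\mathcal U$, $V\in\mathcal V$. Cotorsion pair: a pair $(\mathcal U,\mathcal V)$ of full additive subcategories of $\mathcal B$, closed under direct summands, such that $\mathrm{Ext}^1_{\mathcal B}(\mathcal U,\mathcal V)=0$ and every $B\in\mathcal B$ admits short exact sequences $V_B\rightarrowtail U_B\twoheadrightarrow B$ and $B\rightarrowtail V^B\twoheadrightarrow U^B$ with $U_B,U^B\in\mathcal U$, $V_B,V^B\in\mathcal V$. $\mathcal B^+$ is the full subcategory of objects $B$ admitting a short exact sequence $V_B\rightarrowtail U_B\twoheadrightarrow B$ with $U_B\in\mathcal U\cap\mathcal V$, $V_B\in\mathcal V$. $\mathcal B^-$ is the full subcategory of objects $B$ admitting a short exact sequence $B\rightarrowtail V^B\twoheadrightarrow U^B$ with $V^B\in\mathcal U\cap\mathcal V$, $U^B\in\mathcal U$. The quotient by $\mathcal U\cap\mathcal V$ is the additive quotient category (morphisms modulo those factoring through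 an object of $\mathcal U\cap\mathcal V$). *)

theory Defs
  imports "HOL-Algebra.Ring"
begin

section \<open>Preadditive and additive categories\<close>

text \<open>
  The addition is a single operation on arrows, used on each hom-set separately.
  Only the values of \<open>Hom\<close> on pairs of elements of \<open>Ob\<close> are meaningful, so arrows
  are always introduced through \<open>arr\<close>.
\<close>

record ('o, 'm) cat =
  Ob :: "'o set"
  Hom :: "'o \<Rightarrow> 'o \<Rightarrow> 'm set"
  Idt :: "'o \<Rightarrow> 'm"
  Comp :: "'m \<Rightarrow> 'm \<Rightarrow> 'm"  (infixl \<open>\<cdot>\<index>\<close> 70)
  Add :: "'m \<Rightarrow> 'm \<Rightarrow> 'm"  (infixl \<open>\<uplus>\<index>\<close> 65)
  Zero :: "'o \<Rightarrow> 'o \<Rightarrow> 'm"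

definition arr :: "('o, 'm, 'x) cat_scheme \<Rightarrow> 'o \<Rightarrow> 'o \<Rightarrow> 'm \<Rightarrow> bool" where
  "arr C X Y f \<longleftrightarrow> X \<in> Ob C \<and> Y \<in> Ob C \<and> f \<in> Hom C X Y"

definition hom_group :: "('o, 'm, 'x) cat_scheme \<Rightarrow> 'o \<Rightarrow> 'o \<Rightarrow> 'm monoid" where
  "hom_group C X Y = \<lparr>carrier = Hom C X Y, mult = Add C, one = Zero C X Y\<rparr>"

text \<open>The composite \<open>g \<cdot> f\<close> means first \<open>f\<close>, then \<open>g\<close>.\<close>

locale preadditive_category =
  fixes C :: "('o, 'm, 'x) cat_scheme" (structure)
  assumes arr_unique: "\<lbrakk>arr C X Y f; arr C X' Y' f\<rbrakk> \<Longrightarrow> X = X' \<and> Y = Y'"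
    and arr_Idt: "X \<in> Ob C \<Longrightarrow> arr C X X (Idt C X)"
    and arr_Comp: "\<lbrakk>arr C X Y f; arr C Y Z g\<rbrakk> \<Longrightarrow> arr C X Z (g \<cdot> f)"
    and Comp_assoc: "\<lbrakk>arr C W X f; arr C X Y g; arr C Y Z h\<rbrakk> \<Longrightarrow> (h \<cdot> g) \<cdot> f = h \<cdot> (g \<cdot> f)"
    and Comp_Idt_left: "arr C X Y f \<Longrightarrow> Idt C Y \<cdot> f = f"
    and Comp_Idt_right: "arr C X Y f \<Longrightarrow> f \<cdot> Idt C X = f"
    and comm_group_hom: "\<lbrakk>X \<in> Ob C; Y \<in> Ob C\<rbrakk> \<Longrightarrow> comm_group (hom_group C X Y)"
    and Comp_Add_left: "\<lbrakk>arr C X Y f; arr C Y Z g; arr C Y Z h\<rbrakk> \<Longrightarrow> (g \<uplus> h) \<cdot> f = (g \<cdot> f) \<uplus> (h \<cdot> f)"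
    and Comp_Add_right: "\<lbrakk>arr C X Y f; arr C X Y g; arr C Y Z h\<rbrakk> \<Longrightarrow> h \<cdot> (f \<uplus> g) = (h \<cdot> f) \<uplus> (h \<cdot> g)"

definition is_zero_object :: "('o, 'm, 'x) cat_scheme \<Rightarrow> 'o \<Rightarrow> bool" where
  "is_zero_object C Z \<longleftrightarrow> Z \<in> Ob C \<and> (\<forall>X\<in>Ob C. (\<exists>!f. arr C X Z f) \<and> (\<exists>!f. arr C Z X f))"

definition is_biproduct ::
  "('o, 'm, 'x) cat_scheme \<Rightarrow> 'o \<Rightarrow> 'o \<Rightarrow> 'o \<Rightarrow> 'm \<Rightarrow> 'm \<Rightarrow> 'm \<Rightarrow> 'm \<Rightarrow> bool" where
  "is_biproduct C A B S i1 i2 p1 p2 \<longleftrightarrow>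
     arr C A S i1 \<and> arr C B S i2 \<and> arr C S A p1 \<and> arr C S B p2 \<and>
     p1 \<cdot>\<^bsub>C\<^esub> i1 = Idt C A \<and> p2 \<cdot>\<^bsub>C\<^esub> i2 = Idt C B \<and>
     p2 \<cdot>\<^bsub>C\<^esub> i1 = Zero C A B \<and> p1 \<cdot>\<^bsub>C\<^esub> i2 = Zero C B A \<and>
     (i1 \<cdot>\<^bsub>C\<^esub> p1) \<uplus>\<^bsub>C\<^esub> (i2 \<cdot>\<^bsub>C\<^esub> p2) = Idt C S"

definition is_direct_sum :: "('o, 'm, 'x) cat_scheme \<Rightarrow> 'o \<Rightarrow> 'o \<Rightarrow> 'o \<Rightarrow> bool" where
  "is_direct_sum C A B S \<longleftrightarrow> (\<exists>i1 i2 p1 p2. is_biproduct C A B S i1 i2 p1 p2)"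

locale additive_category = preadditive_category C
  for C :: "('o, 'm, 'x) cat_scheme" (structure) +
  assumes zero_object_exists: "\<exists>Z. is_zero_object C Z"
    and direct_sum_exists: "\<lbrakk>A \<in> Ob C; B \<in> Ob C\<rbrakk> \<Longrightarrow> \<exists>S. is_direct_sum C A B S"


section \<open>Kernels, cokernels and abelian categories\<close>

definition is_iso :: "('o, 'm, 'x) cat_scheme \<Rightarrow> 'o \<Rightarrow> 'o \<Rightarrow> 'm \<Rightarrow> bool" where
  "is_iso C X Y f \<longleftrightarrow> arr C X Y f \<and>
     (\<exists>g. arr C Y X g \<and> g \<cdot>\<^bsub>C\<^esub> f = Idt C X \<and> f \<cdot>\<^bsub>C\<^esub> g = Idt C Y)"

definition is_mono :: "('o, 'm, 'x) cat_scheme \<Rightarrow> 'o \<Rightarrow> 'o \<Rightarrow> 'm \<Rightarrow> bool" where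
  "is_mono C X Y f \<longleftrightarrow> arr C X Y f \<and>
     (\<forall>T g h. arr C T X g \<and> arr C T X h \<and> f \<cdot>\<^bsub>C\<^esub> g = f \<cdot>\<^bsub>C\<^esub> h \<longrightarrow> g = h)"

definition is_epi :: "('o, 'm, 'x) cat_scheme \<Rightarrow> 'o \<Rightarrow> 'o \<Rightarrow> 'm \<Rightarrow> bool" where
  "is_epi C X Y f \<longleftrightarrow> arr C X Y f \<and>
     (\<forall>T g h. arr C Y T g \<and> arr C Y T h \<and> g \<cdot>\<^bsub>C\<^esub> f = h \<cdot>\<^bsub>C\<^esub> f \<longrightarrow> g = h)"

definition is_kernel :: "('o, 'm, 'x) cat_scheme \<Rightarrow> 'o \<Rightarrow> 'o \<Rightarrow> 'o \<Rightarrow> 'm \<Rightarrow> 'm \<Rightarrow> bool" where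
  "is_kernel C K X Y k f \<longleftrightarrow> arr C K X k \<and> arr C X Y f \<and> f \<cdot>\<^bsub>C\<^esub> k = Zero C K Y \<and>
     (\<forall>T t. arr C T X t \<and> f \<cdot>\<^bsub>C\<^esub> t = Zero C T Y \<longrightarrow> (\<exists>!u. arr C T K u \<and> k \<cdot>\<^bsub>C\<^esub> u = t))"

definition is_cokernel :: "('o, 'm, 'x) cat_scheme \<Rightarrow> 'o \<Rightarrow> 'o \<Rightarrow> 'o \<Rightarrow> 'm \<Rightarrow> 'm \<Rightarrow> bool" where
  "is_cokernel C X Y Q f q \<longleftrightarrow> arr C X Y f \<and> arr C Y Q q \<and> q \<cdot>\<^bsub>C\<^esub> f = Zero C X Q \<and>
     (\<forall>T t. arr C Y T t \<and> t \<cdot>\<^bsub>C\<^esub> f = Zero C X T \<longrightarrow> (\<exists>!u. arr C Q T u \<and> u \<cdot>\<^bsub>C\<^esub> q = t))"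

locale abelian_category = additive_category C
  for C :: "('o, 'm, 'x) cat_scheme" (structure) +
  assumes kernel_exists: "arr C X Y f \<Longrightarrow> \<exists>K k. is_kernel C K X Y k f"
    and cokernel_exists: "arr C X Y f \<Longrightarrow> \<exists>Q q. is_cokernel C X Y Q f q"
    and mono_is_kernel: "is_mono C X Y f \<Longrightarrow> \<exists>Z g. is_kernel C X Y Z f g"
    and epi_is_cokernel: "is_epi C X Y f \<Longrightarrow> \<exists>W g. is_cokernel C W X Y g f"


section \<open>Krull--Schmidt categories\<close>

locale local_ring = ring R for R (structure) +
  assumes one_neq_zero: "\<one> \<noteq> \<zero>"
    and nonunits_add: "\<lbrakk>a \<in> carrier R - Units R; b \<in> carrier R - Units R\<rbrakk> \<Longrightarrow> a \<oplus> b \<notin> Units R"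

definition end_ring :: "('o, 'm, 'x) cat_scheme \<Rightarrow> 'o \<Rightarrow> 'm ring" where
  "end_ring C X = \<lparr>carrier = Hom C X X, mult = Comp C, one = Idt C X,
                   zero = Zero C X X, add = Add C\<rparr>"

text \<open>Finite, possibly empty, direct sums of objects taken from \<open>P\<close>.\<close>

inductive finite_direct_sum :: "('o, 'm, 'x) cat_scheme \<Rightarrow> 'o set \<Rightarrow> 'o \<Rightarrow> bool"
  for C :: "('o, 'm, 'x) cat_scheme" and P :: "'o set" where
  empty: "is_zero_object C Z \<Longrightarrow> finite_direct_sum C P Z"
| insert: "\<lbrakk>A \<in> P; finite_direct_sum C P B; is_direct_sum C A B S\<rbrakk> \<Longrightarrow> finite_direct_sum C P S"

locale krull_schmidt_category = additive_category C
  for C :: "('o, 'm, 'x) cat_scheme" (structure) +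
  assumes krull_schmidt: "X \<in> Ob C \<Longrightarrow> finite_direct_sum C {A \<in> Ob C. local_ring (end_ring C A)} X"


section \<open>Exact categories\<close>

definition is_pullback ::
  "('o, 'm, 'x) cat_scheme \<Rightarrow> 'o \<Rightarrow> 'o \<Rightarrow> 'o \<Rightarrow> 'o \<Rightarrow> 'm \<Rightarrow> 'm \<Rightarrow> 'm \<Rightarrow> 'm \<Rightarrow> bool" where
  "is_pullback C P A B Z p q f g \<longleftrightarrow>
     arr C P A p \<and> arr C P B q \<and> arr C A Z f \<and> arr C B Z g \<and> f \<cdot>\<^bsub>C\<^esub> p = g \<cdot>\<^bsub>C\<^esub> q \<and>
     (\<forall>T s t. arr C T A s \<and> arr C T B t \<and> f \<cdot>\<^bsub>C\<^esub> s = g \<cdot>\<^bsub>C\<^esub> t \<longrightarrow>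
        (\<exists>!u. arr C T P u \<and> p \<cdot>\<^bsub>C\<^esub> u = s \<and> q \<cdot>\<^bsub>C\<^esub> u = t))"

definition is_pushout ::
  "('o, 'm, 'x) cat_scheme \<Rightarrow> 'o \<Rightarrow> 'o \<Rightarrow> 'o \<Rightarrow> 'o \<Rightarrow> 'm \<Rightarrow> 'm \<Rightarrow> 'm \<Rightarrow> 'm \<Rightarrow> bool" where
  "is_pushout C Z A B P f g p q \<longleftrightarrow>
     arr C Z A f \<and> arr C Z B g \<and> arr C A P p \<and> arr C B P q \<and> p \<cdot>\<^bsub>C\<^esub> f = q \<cdot>\<^bsub>C\<^esub> g \<and>
     (\<forall>T s t. arr C A T s \<and> arr C B T t \<and> s \<cdot>\<^bsub>C\<^esub> f = t \<cdot>\<^bsub>C\<^esub> g \<longrightarrow>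
        (\<exists>!u. arr C P T u \<and> u \<cdot>\<^bsub>C\<^esub> p = s \<and> u \<cdot>\<^bsub>C\<^esub> q = t))"

definition kernel_cokernel_pair ::
  "('o, 'm, 'x) cat_scheme \<Rightarrow> 'o \<Rightarrow> 'o \<Rightarrow> 'o \<Rightarrow> 'm \<Rightarrow> 'm \<Rightarrow> bool" where
  "kernel_cokernel_pair C X Y Z i d \<longleftrightarrow> is_kernel C X Y Z i d \<and> is_cokernel C X Y Z i d"

text \<open>
  The sequence \<open>X \<rightarrow> Y \<rightarrow> Z\<close> given by \<open>(i, d)\<close> is, for some choice of the three biproducts,
  the direct sum of the sequences \<open>X1 \<rightarrow> Y1 \<rightarrow> Z1\<close> and \<open>X2 \<rightarrow> Y2 \<rightarrow> Z2\<close>.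
\<close>

definition is_sum_of_sequences ::
  "('o, 'm, 'x) cat_scheme \<Rightarrow> 'o \<Rightarrow> 'o \<Rightarrow> 'o \<Rightarrow> 'm \<Rightarrow> 'm \<Rightarrow>
     'o \<Rightarrow> 'o \<Rightarrow> 'o \<Rightarrow> 'm \<Rightarrow> 'm \<Rightarrow> 'o \<Rightarrow> 'o \<Rightarrow> 'o \<Rightarrow> 'm \<Rightarrow> 'm \<Rightarrow> bool" where
  "is_sum_of_sequences C X1 Y1 Z1 i1 d1 X2 Y2 Z2 i2 d2 X Y Z i d \<longleftrightarrow>
     arr C X1 Y1 i1 \<and> arr C Y1 Z1 d1 \<and> arr C X2 Y2 i2 \<and> arr C Y2 Z2 d2 \<and>
     (\<exists>a1 a2 p1 p2 b1 b2 q1 q2 c1 c2 r1 r2.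
        is_biproduct C X1 X2 X a1 a2 p1 p2 \<and>
        is_biproduct C Y1 Y2 Y b1 b2 q1 q2 \<and>
        is_biproduct C Z1 Z2 Z c1 c2 r1 r2 \<and>
        i = (b1 \<cdot>\<^bsub>C\<^esub> i1 \<cdot>\<^bsub>C\<^esub> p1) \<uplus>\<^bsub>C\<^esub> (b2 \<cdot>\<^bsub>C\<^esub> i2 \<cdot>\<^bsub>C\<^esub> p2) \<and>
        d = (c1 \<cdot>\<^bsub>C\<^esub> d1 \<cdot>\<^bsub>C\<^esub> q1) \<uplus>\<^bsub>C\<^esub> (c2 \<cdot>\<^bsub>C\<^esub> d2 \<cdot>\<^bsub>C\<^esub> q2))"

definition inflation :: "('m \<times> 'm) set \<Rightarrow> 'm \<Rightarrow> bool" where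
  "inflation E i \<longleftrightarrow> (\<exists>d. (i, d) \<in> E)"

definition deflation :: "('m \<times> 'm) set \<Rightarrow> 'm \<Rightarrow> bool" where
  "deflation E d \<longleftrightarrow> (\<exists>i. (i, d) \<in> E)"

definition ses :: "('o, 'm, 'x) cat_scheme \<Rightarrow> ('m \<times> 'm) set \<Rightarrow> 'o \<Rightarrow> 'o \<Rightarrow> 'o \<Rightarrow> 'm \<Rightarrow> 'm \<Rightarrow> bool" where
  "ses C E X Y Z i d \<longleftrightarrow> arr C X Y i \<and> arr C Y Z d \<and> (i, d) \<in> E"

locale exact_category = additive_category C
  for C :: "('o, 'm, 'x) cat_scheme" (structure) +
  fixes E :: "('m \<times> 'm) set"
  assumes E_kernel_cokernel: "(i, d) \<in> E \<Longrightarrow> \<exists>X Y Z. kernel_cokernel_pair C X Y Z i d"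
    and E_iso_closed:
      "\<lbrakk>ses C E X Y Z i d; arr C X' Y' i'; arr C Y' Z' d';
        is_iso C X X' a; is_iso C Y Y' b; is_iso C Z Z' c; b \<cdot> i = i' \<cdot> a; c \<cdot> d = d' \<cdot> b\<rbrakk>
       \<Longrightarrow> (i', d') \<in> E"
    and E_sum_closed:
      "\<lbrakk>(i1, d1) \<in> E; (i2, d2) \<in> E;
        is_sum_of_sequences C X1 Y1 Z1 i1 d1 X2 Y2 Z2 i2 d2 X Y Z i d\<rbrakk> \<Longrightarrow> (i, d) \<in> E"
    and E_summand_closed:
      "\<lbrakk>(i, d) \<in> E; kernel_cokernel_pair C X1 Y1 Z1 i1 d1; kernel_cokernel_pair C X2 Y2 Z2 i2 d2;
        is_sum_of_sequences C X1 Y1 Z1 i1 d1 X2 Y2 Z2 i2 d2 X Y Z i d\<rbrakk>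
       \<Longrightarrow> (i1, d1) \<in> E \<and> (i2, d2) \<in> E"
    and inflation_Idt_zero: "is_zero_object C Z \<Longrightarrow> inflation E (Idt C Z)"
    and deflation_Idt_zero: "is_zero_object C Z \<Longrightarrow> deflation E (Idt C Z)"
    and inflation_Comp:
      "\<lbrakk>arr C X Y i; arr C Y Z j; inflation E i; inflation E j\<rbrakk> \<Longrightarrow> inflation E (j \<cdot> i)"
    and deflation_Comp:
      "\<lbrakk>arr C X Y d; arr C Y Z e; deflation E d; deflation E e\<rbrakk> \<Longrightarrow> deflation E (e \<cdot> d)"
    and inflation_pushout:
      "\<lbrakk>arr C X Y i; inflation E i; arr C X X' g\<rbrakk>
       \<Longrightarrow> \<exists>Y' i' g'. is_pushout C X Y X' Y' i g g' i' \<and> inflation E i'"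
    and deflation_pullback:
      "\<lbrakk>arr C Y Z d; deflation E d; arr C Z' Z f\<rbrakk>
       \<Longrightarrow> \<exists>Y' d' f'. is_pullback C Y' Y Z' Z f' d' d f \<and> deflation E d'"

definition is_projective :: "('o, 'm, 'x) cat_scheme \<Rightarrow> ('m \<times> 'm) set \<Rightarrow> 'o \<Rightarrow> bool" where
  "is_projective C E P \<longleftrightarrow> P \<in> Ob C \<and>
     (\<forall>Y Z d f. arr C Y Z d \<and> deflation E d \<and> arr C P Z f \<longrightarrow> (\<exists>g. arr C P Y g \<and> d \<cdot>\<^bsub>C\<^esub> g = f))"

definition is_injective :: "('o, 'm, 'x) cat_scheme \<Rightarrow> ('m \<times> 'm) set \<Rightarrow> 'o \<Rightarrow> bool" where
  "is_injective C E I \<longleftrightarrow> I \<in> Ob C \<and>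
     (\<forall>X Y i f. arr C X Y i \<and> inflation E i \<and> arr C X I f \<longrightarrow> (\<exists>g. arr C Y I g \<and> g \<cdot>\<^bsub>C\<^esub> i = f))"

definition enough_projectives :: "('o, 'm, 'x) cat_scheme \<Rightarrow> ('m \<times> 'm) set \<Rightarrow> bool" where
  "enough_projectives C E \<longleftrightarrow>
     (\<forall>X\<in>Ob C. \<exists>P d. is_projective C E P \<and> arr C P X d \<and> deflation E d)"

definition enough_injectives :: "('o, 'm, 'x) cat_scheme \<Rightarrow> ('m \<times> 'm) set \<Rightarrow> bool" where
  "enough_injectives C E \<longleftrightarrow>
     (\<forall>X\<in>Ob C. \<exists>I i. is_injective C E I \<and> arr C X I i \<and> inflation E i)"


section \<open>Yoneda extensions and cotorsion pairs\<close>

text \<open>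
  \<open>Ext1 C E U V\<close> is the set of Yoneda classes of extensions \<open>V \<rightarrow> Y \<rightarrow> U\<close> in \<open>E\<close>;
  \<open>Ext1_zero\<close> is its neutral element for the Baer sum, the class of the split extensions.
\<close>

definition extensions ::
  "('o, 'm, 'x) cat_scheme \<Rightarrow> ('m \<times> 'm) set \<Rightarrow> 'o \<Rightarrow> 'o \<Rightarrow> ('o \<times> 'm \<times> 'm) set" where
  "extensions C E U V = {(Y, i, d). ses C E V Y U i d}"

definition extension_equiv ::
  "('o, 'm, 'x) cat_scheme \<Rightarrow> ('m \<times> 'm) set \<Rightarrow> 'o \<Rightarrow> 'o \<Rightarrow>
     (('o \<times> 'm \<times> 'm) \<times> ('o \<times> 'm \<times> 'm)) set" where
  "extension_equiv C E U V =
     {((Y, i, d), (Y', i', d')). (Y, i, d) \<in> extensions C E U V \<and> (Y', i', d') \<in> extensions C E U V \<and>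
        (\<exists>\<phi>. is_iso C Y Y' \<phi> \<and> \<phi> \<cdot>\<^bsub>C\<^esub> i = i' \<and> d' \<cdot>\<^bsub>C\<^esub> \<phi> = d)}"

definition Ext1 ::
  "('o, 'm, 'x) cat_scheme \<Rightarrow> ('m \<times> 'm) set \<Rightarrow> 'o \<Rightarrow> 'o \<Rightarrow> ('o \<times> 'm \<times> 'm) set set" where
  "Ext1 C E U V = extensions C E U V // extension_equiv C E U V"

definition Ext1_zero ::
  "('o, 'm, 'x) cat_scheme \<Rightarrow> ('m \<times> 'm) set \<Rightarrow> 'o \<Rightarrow> 'o \<Rightarrow> ('o \<times> 'm \<times> 'm) set" where
  "Ext1_zero C E U V =
     {(Y, i, d). (Y, i, d) \<in> extensions C E U V \<and> (\<exists>s r. is_biproduct C V U Y i s r d)}"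

definition is_additive_subcategory :: "('o, 'm, 'x) cat_scheme \<Rightarrow> 'o set \<Rightarrow> bool" where
  "is_additive_subcategory C U \<longleftrightarrow> U \<subseteq> Ob C \<and> (\<exists>Z\<in>U. is_zero_object C Z) \<and>
     (\<forall>A\<in>U. \<forall>B\<in>U. \<exists>S\<in>U. is_direct_sum C A B S)"

definition closed_under_summands :: "('o, 'm, 'x) cat_scheme \<Rightarrow> 'o set \<Rightarrow> bool" where
  "closed_under_summands C U \<longleftrightarrow> (\<forall>A B S. S \<in> U \<and> is_direct_sum C A B S \<longrightarrow> A \<in> U \<and> B \<in> U)"

locale cotorsion_pair = exact_category C E
  for C :: "('o, 'm, 'x) cat_scheme" (structure) and E +
  fixes U V :: "'o set"
  assumes U_additive: "is_additive_subcategory C U"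
    and V_additive: "is_additive_subcategory C V"
    and U_summands: "closed_under_summands C U"
    and V_summands: "closed_under_summands C V"
    and Ext1_vanishes: "\<lbrakk>A \<in> U; B \<in> V\<rbrakk> \<Longrightarrow> Ext1 C E A B = {Ext1_zero C E A B}"
    and left_approximation:
      "B \<in> Ob C \<Longrightarrow> \<exists>V\<^sub>B U\<^sub>B i d. V\<^sub>B \<in> V \<and> U\<^sub>B \<in> U \<and> ses C E V\<^sub>B U\<^sub>B B i d"
    and right_approximation:
      "B \<in> Ob C \<Longrightarrow> \<exists>V' U' i d. V' \<in> V \<and> U' \<in> U \<and> ses C E B V' U' i d"


section \<open>The heart\<close>

definition B_plus ::
  "('o, 'm, 'x) cat_scheme \<Rightarrow> ('m \<times> 'm) set \<Rightarrow> 'o set \<Rightarrow> 'o set \<Rightarrow> 'o set" where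
  "B_plus C E U V =
     {B \<in> Ob C. \<exists>V\<^sub>B U\<^sub>B i d. V\<^sub>B \<in> V \<and> U\<^sub>B \<in> U \<inter> V \<and> ses C E V\<^sub>B U\<^sub>B B i d}"

definition B_minus ::
  "('o, 'm, 'x) cat_scheme \<Rightarrow> ('m \<times> 'm) set \<Rightarrow> 'o set \<Rightarrow> 'o set \<Rightarrow> 'o set" where
  "B_minus C E U V =
     {B \<in> Ob C. \<exists>V' U' i d. V' \<in> U \<inter> V \<and> U' \<in> U \<and> ses C E B V' U' i d}"

definition full_subcategory :: "('o, 'm) cat \<Rightarrow> 'o set \<Rightarrow> ('o, 'm) cat" where
  "full_subcategory C S = C\<lparr>Ob := S\<rparr>"

definition factoring_through :: "('o, 'm, 'x) cat_scheme \<Rightarrow> 'o set \<Rightarrow> 'o \<Rightarrow> 'o \<Rightarrow> 'm set" where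
  "factoring_through C W X Y = {b \<cdot>\<^bsub>C\<^esub> a | a b M. M \<in> W \<and> arr C X M a \<and> arr C M Y b}"

definition mor_class :: "('o, 'm, 'x) cat_scheme \<Rightarrow> 'o set \<Rightarrow> 'o \<Rightarrow> 'o \<Rightarrow> 'm \<Rightarrow> 'm set" where
  "mor_class C W X Y f = {f \<uplus>\<^bsub>C\<^esub> h | h. h \<in> factoring_through C W X Y}"

text \<open>
  The arrows of the quotient are the cosets of the subgroups \<open>factoring_through C W X Y\<close>.
  The composite of two cosets is the coset of the composite of any representatives; the
  objects \<open>X\<close>, \<open>Y\<close>, \<open>Z\<close> in its definition are determined by the cosets.
\<close>

definition additive_quotient :: "('o, 'm) cat \<Rightarrow> 'o set \<Rightarrow> ('o, 'm set) cat" where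
  "additive_quotient C W =
     \<lparr>Ob = Ob C,
      Hom = (\<lambda>X Y. mor_class C W X Y ` Hom C X Y),
      Idt = (\<lambda>X. mor_class C W X X (Idt C X)),
      Comp = (\<lambda>G F. \<Union>{mor_class C W X Z (g \<cdot>\<^bsub>C\<^esub> f) | X Y Z f g.
                          f \<in> F \<and> g \<in> G \<and> arr C X Y f \<and> arr C Y Z g}),
      Add = (\<lambda>F G. {f \<uplus>\<^bsub>C\<^esub> g | f g. f \<in> F \<and> g \<in> G}),
      Zero = factoring_through C W\<rparr>"

definition heart ::
  "('o, 'm) cat \<Rightarrow> ('m \<times> 'm) set \<Rightarrow> 'o set \<Rightarrow> 'o set \<Rightarrow> ('o, 'm set) cat" where
  "heart C E U V =
     additive_quotient (full_subcategory C (B_plus C E U V \<inter> B_minus C E U V)) (U \<inter> V)"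

end

theory Submission
  imports Defs
begin

text \<open>
  Write \<open>W = U \<inter> V\<close> and call an arrow null if it factors through an object of \<open>W\<close>. Everything
  rests on the vanishing of \<open>Ext\<^sup>1(U, V)\<close>: arrows into \<open>V\<close> extend along inflations with cokernel in
  \<open>U\<close> (\<open>extend_to_V\<close>), arrows from \<open>U\<close> lift along deflations with kernel in \<open>V\<close>, and both classes
  are closed under extensions. Hence an arrow to an object of \<open>B\<^sup>+\<close> is null as soon as its
  restriction along an inflation with cokernel in \<open>U\<close> is null (\<open>null_extension\<close>), and \<open>B\<^sup>-\<close> is
  closed under extensions by \<open>U\<close> on the right (\<open>B_minus_extension\<close>).

  Cokernels. For \<open>f : A \<rightarrow> B\<close> in the heart, push out a sequence \<open>A \<rightarrow> W\<^sub>A \<rightarrow> U\<^sub>A\<close> with \<open>W\<^sub>A\<close> in \<open>W\<close> and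
  \<open>U\<^sub>A\<close> in \<open>U\<close> along \<open>f\<close>. This gives an inflation \<open>B \<rightarrow> P\<close> with cokernel \<open>U\<^sub>A\<close> along which exactly the
  arrows \<open>t\<close> with \<open>t f\<close> null extend. The object \<open>P\<close> lies in \<open>B\<^sup>-\<close>, and its reflection \<open>Q\<close> into \<open>B\<^sup>+\<close>
  (\<open>B_plus_reflection\<close>) is again the end of an inflation \<open>P \<rightarrow> Q\<close> with cokernel in \<open>U\<close>. So \<open>Q\<close> lies in
  the heart, and \<open>B \<rightarrow> Q\<close> is a cokernel of \<open>f\<close> modulo null arrows (\<open>null_cokernel_exists\<close>).

  Epimorphisms. If \<open>f\<close> is epi modulo null arrows, then \<open>B \<rightarrow> Q\<close> is null, hence so is \<open>P \<rightarrow> Q\<close>, and this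
  forces \<open>P\<close> into \<open>U\<close>. Up to a summand in \<open>W\<close>, the arrow \<open>f\<close> is the inflation \<open>A \<rightarrow> B \<oplus> W\<^sub>A\<close>, whose
  cokernel is \<open>P\<close>. Choose a deflation \<open>W\<^sub>1 \<rightarrow> B \<oplus> W\<^sub>A\<close> with kernel in \<open>V\<close> and \<open>W\<^sub>1\<close> in \<open>W\<close>, and let \<open>K\<close> be
  its pullback along that inflation. As \<open>K \<rightarrow> W\<^sub>1\<close> is an inflation with cokernel \<open>P\<close> in \<open>U\<close>, the object
  \<open>K\<close> is in the heart and every null arrow from \<open>K\<close> factors through \<open>W\<^sub>1\<close>. The pullback square is
  also a pushout, so an arrow from \<open>A\<close> that is null on \<open>K\<close> factors through \<open>B \<oplus> W\<^sub>A\<close>. Thus \<open>f\<close> is a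
  cokernel of \<open>K \<rightarrow> A\<close> modulo null arrows (\<open>null_epi_is_cokernel\<close>).

  Kernels and monomorphisms follow by duality: \<open>(V, U)\<close> is a cotorsion pair on the opposite
  category, and its heart is the opposite of the heart of \<open>(U, V)\<close>.
\<close>

section \<open>Calculus in a preadditive category\<close>

context preadditive_category
begin

text \<open>
  Source and target as functions turn every typing condition \<open>arr C X Y f\<close> into equations
  (\<open>arr_iff\<close>), so that composites can be normalised by conditional rewriting.
\<close>

definition arrow :: "'m \<Rightarrow> bool" where
  "arrow f \<longleftrightarrow> (\<exists>X Y. arr C X Y f)"

definition src :: "'m \<Rightarrow> 'o" where
  "src f = (THE X. \<exists>Y. arr C X Y f)"

definition trg :: "'m \<Rightarrow> 'o" where
  "trg f = (THE Y. \<exists>X. arr C X Y f)"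

definition neg :: "'m \<Rightarrow> 'm" where
  "neg f = inv\<^bsub>hom_group C (src f) (trg f)\<^esub> f"

lemma arr_iff: "arr C X Y f \<longleftrightarrow> arrow f \<and> src f = X \<and> trg f = Y"
proof -
  have *: "src f = X \<and> trg f = Y" if "arr C X Y f" for X Y
    using that unfolding src_def trg_def by (auto intro!: the_equality dest: arr_unique)
  then show ?thesis
    unfolding arrow_def by metis
qed

lemma arrow_Ob [simp]: "arrow f \<Longrightarrow> src f \<in> Ob C" "arrow f \<Longrightarrow> trg f \<in> Ob C"
  using arr_iff unfolding arr_def by blast+

lemma arr_Ob: "arr C X Y f \<Longrightarrow> X \<in> Ob C \<and> Y \<in> Ob C"
  unfolding arr_def by blast

lemma arrow_Comp [simp]:
  assumes "arrow f" "arrow g" "trg f = src g"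
  shows "arrow (g \<cdot> f)" "src (g \<cdot> f) = src f" "trg (g \<cdot> f) = trg g"
  using arr_Comp[of "src f" "trg f" f "trg g" g] assms by (auto simp: arr_iff)

lemma Comp_assoc_arrow [simp]:
  assumes "arrow f" "arrow g" "arrow h" "trg f = src g" "trg g = src h"
  shows "(h \<cdot> g) \<cdot> f = h \<cdot> (g \<cdot> f)"
  using Comp_assoc[of "src f" "trg f" f "trg g" g "trg h" h] assms by (auto simp: arr_iff)

lemma arrow_Idt [simp]:
  assumes "X \<in> Ob C"
  shows "arrow (Idt C X)" "src (Idt C X) = X" "trg (Idt C X) = X"
  using arr_Idt[OF assms] by (auto simp: arr_iff)

lemma Comp_Idt [simp]:
  "\<lbrakk>arrow f; trg f = X\<rbrakk> \<Longrightarrow> Idt C X \<cdot> f = f"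
  "\<lbrakk>arrow f; src f = X\<rbrakk> \<Longrightarrow> f \<cdot> Idt C X = f"
  using Comp_Idt_left[of "src f" X f] Comp_Idt_right[of X "trg f" f] by (auto simp: arr_iff)

lemma carrier_hom_group:
  "\<lbrakk>X \<in> Ob C; Y \<in> Ob C\<rbrakk> \<Longrightarrow> f \<in> carrier (hom_group C X Y) \<longleftrightarrow> arrow f \<and> src f = X \<and> trg f = Y"
  using arr_iff[of X Y f] unfolding arr_def by (simp add: hom_group_def)

lemma hom_group_sel [simp]:
  "mult (hom_group C X Y) = Add C" "one (hom_group C X Y) = Zero C X Y"
  by (simp_all add: hom_group_def)

lemma arrow_Zero [simp]:
  assumes "X \<in> Ob C" "Y \<in> Ob C"
  shows "arrow (Zero C X Y)" "src (Zero C X Y) = X" "trg (Zero C X Y) = Y"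
proof -
  interpret comm_group "hom_group C X Y" by (rule comm_group_hom[OF assms])
  show "arrow (Zero C X Y)" "src (Zero C X Y) = X" "trg (Zero C X Y) = Y"
    using one_closed carrier_hom_group[OF assms] by auto
qed

lemma arrow_Add [simp]:
  assumes "arrow f" "arrow g" "src f = src g" "trg f = trg g"
  shows "arrow (f \<uplus> g)" "src (f \<uplus> g) = src g" "trg (f \<uplus> g) = trg g"
proof -
  have O: "src g \<in> Ob C" "trg g \<in> Ob C" using assms by auto
  interpret comm_group "hom_group C (src g) (trg g)" by (rule comm_group_hom[OF O])
  show "arrow (f \<uplus> g)" "src (f \<uplus> g) = src g" "trg (f \<uplus> g) = trg g"
    using m_closed[of f g] carrier_hom_group[OF O] assms by auto
qed

lemma Add_ac:
  assumes "arrow f" "arrow g" "src f = src g" "trg f = trg g"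
  shows Add_commute: "f \<uplus> g = g \<uplus> f"
    and Add_assoc: "\<lbrakk>arrow h; src h = src g; trg h = trg g\<rbrakk> \<Longrightarrow> (f \<uplus> g) \<uplus> h = f \<uplus> (g \<uplus> h)"
    and Add_left_commute: "\<lbrakk>arrow h; src h = src g; trg h = trg g\<rbrakk> \<Longrightarrow> f \<uplus> (g \<uplus> h) = g \<uplus> (f \<uplus> h)"
proof -
  have O: "src g \<in> Ob C" "trg g \<in> Ob C" using assms by auto
  interpret comm_group "hom_group C (src g) (trg g)" by (rule comm_group_hom[OF O])
  show "f \<uplus> g = g \<uplus> f"
    using m_comm[of f g] carrier_hom_group[OF O] assms by auto
  show "(f \<uplus> g) \<uplus> h = f \<uplus> (g \<uplus> h)" if "arrow h" "src h = src g" "trg h = trg g"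
    using m_assoc[of f g h] carrier_hom_group[OF O] assms that by auto
  show "f \<uplus> (g \<uplus> h) = g \<uplus> (f \<uplus> h)" if "arrow h" "src h = src g" "trg h = trg g"
    using m_lcomm[of f g h] carrier_hom_group[OF O] assms that by auto
qed

lemma Add_Zero [simp]:
  assumes "arrow f" "src f = X" "trg f = Y"
  shows "f \<uplus> Zero C X Y = f" "Zero C X Y \<uplus> f = f"
proof -
  have O: "X \<in> Ob C" "Y \<in> Ob C" using assms by auto
  interpret comm_group "hom_group C X Y" by (rule comm_group_hom[OF O])
  show "f \<uplus> Zero C X Y = f" "Zero C X Y \<uplus> f = f"
    using l_one[of f] r_one[of f] carrier_hom_group[OF O] assms by auto
qed

lemma arrow_neg [simp]:
  assumes "arrow f"
  shows "arrow (neg f)" "src (neg f) = src f" "trg (neg f) = trg f"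
    "f \<uplus> neg f = Zero C (src f) (trg f)" "neg f \<uplus> f = Zero C (src f) (trg f)"
proof -
  have O: "src f \<in> Ob C" "trg f \<in> Ob C" using assms by auto
  interpret comm_group "hom_group C (src f) (trg f)" by (rule comm_group_hom[OF O])
  show "arrow (neg f)" "src (neg f) = src f" "trg (neg f) = trg f"
    using inv_closed[of f] carrier_hom_group[OF O] assms unfolding neg_def by auto
  show "f \<uplus> neg f = Zero C (src f) (trg f)" "neg f \<uplus> f = Zero C (src f) (trg f)"
    using r_inv[of f] l_inv[of f] carrier_hom_group[OF O] assms unfolding neg_def by auto
qed

lemma Add_cancel:
  assumes "arrow f" "arrow g" "arrow h" "src g = src f" "trg g = trg f" "src h = src f" "trg h = trg f"
    and "f \<uplus> g = f \<uplus> h"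
  shows "g = h"
proof -
  have O: "src f \<in> Ob C" "trg f \<in> Ob C" using assms by auto
  interpret comm_group "hom_group C (src f) (trg f)" by (rule comm_group_hom[OF O])
  show ?thesis
    using right_cancel[of f g h] m_comm[of f g] m_comm[of f h] carrier_hom_group[OF O] assms by auto
qed

lemma Comp_Add [simp]:
  "\<lbrakk>arrow f; arrow g; arrow h; trg f = src h; src g = src h; trg g = trg h\<rbrakk>
    \<Longrightarrow> (g \<uplus> h) \<cdot> f = (g \<cdot> f) \<uplus> (h \<cdot> f)"
  "\<lbrakk>arrow f; arrow g; arrow h; trg f = src h; src f = src g; trg f = trg g\<rbrakk>
    \<Longrightarrow> h \<cdot> (f \<uplus> g) = (h \<cdot> f) \<uplus> (h \<cdot> g)"
  using Comp_Add_left[of "src f" "trg f" f "trg h" g h]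
    Comp_Add_right[of "src f" "trg f" f g "trg h" h] by (auto simp: arr_iff)

lemma Comp_Zero [simp]:
  assumes "arrow f"
  shows "\<lbrakk>trg f = X; Y \<in> Ob C\<rbrakk> \<Longrightarrow> Zero C X Y \<cdot> f = Zero C (src f) Y"
    and "\<lbrakk>src f = Y; X \<in> Ob C\<rbrakk> \<Longrightarrow> f \<cdot> Zero C X Y = Zero C X (trg f)"
proof -
  { assume [simp]: "trg f = X" "Y \<in> Ob C"
    have [simp]: "X \<in> Ob C" using arrow_Ob(2)[OF assms] by simp
    have "(Zero C X Y \<uplus> Zero C X Y) \<cdot> f = Zero C X Y \<cdot> f" by (subst Add_Zero) auto
    then have eq: "Zero C X Y \<cdot> f \<uplus> Zero C X Y \<cdot> f = Zero C X Y \<cdot> f \<uplus> Zero C (src f) Y"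
      using assms by (simp del: Add_Zero(1,2) add: Comp_Add) (simp add: Add_Zero)
    show "Zero C X Y \<cdot> f = Zero C (src f) Y"
      by (rule Add_cancel[OF _ _ _ _ _ _ _ eq]) (simp_all add: assms) }
  { assume [simp]: "src f = Y" "X \<in> Ob C"
    have [simp]: "Y \<in> Ob C" using arrow_Ob(1)[OF assms] by simp
    have "f \<cdot> (Zero C X Y \<uplus> Zero C X Y) = f \<cdot> Zero C X Y" by (subst Add_Zero) auto
    then have eq: "f \<cdot> Zero C X Y \<uplus> f \<cdot> Zero C X Y = f \<cdot> Zero C X Y \<uplus> Zero C X (trg f)"
      using assms by (simp del: Add_Zero(1,2) add: Comp_Add) (simp add: Add_Zero)
    show "f \<cdot> Zero C X Y = Zero C X (trg f)"
      by (rule Add_cancel[OF _ _ _ _ _ _ _ eq]) (simp_all add: assms) }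
qed

lemma neg_unique:
  assumes "arrow f" "arrow g" "src g = src f" "trg g = trg f" "f \<uplus> g = Zero C (src f) (trg f)"
  shows "g = neg f"
  by (rule Add_cancel[of f]) (simp_all add: assms)

lemma neg_Zero [simp]:
  assumes "X \<in> Ob C" "Y \<in> Ob C"
  shows "neg (Zero C X Y) = Zero C X Y"
  by (rule neg_unique[symmetric]) (simp_all add: assms)

lemma neg_neg [simp]: "arrow f \<Longrightarrow> neg (neg f) = f"
  by (rule neg_unique[symmetric]) simp_all

lemma Comp_neg [simp]:
  assumes "arrow f" "arrow g" "trg f = src g"
  shows "g \<cdot> neg f = neg (g \<cdot> f)" "neg g \<cdot> f = neg (g \<cdot> f)"
proof -
  have "g \<cdot> (f \<uplus> neg f) = Zero C (src f) (trg g)"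
    using assms by (simp del: Comp_Add)
  moreover have "g \<cdot> (f \<uplus> neg f) = g \<cdot> f \<uplus> g \<cdot> neg f"
    using assms by (simp del: arrow_neg(4) add: arrow_neg(1,2,3))
  ultimately have eq: "g \<cdot> f \<uplus> g \<cdot> neg f = Zero C (src f) (trg g)"
    by simp
  show "g \<cdot> neg f = neg (g \<cdot> f)"
    by (rule neg_unique) (simp_all add: assms eq)
  have "(g \<uplus> neg g) \<cdot> f = Zero C (src f) (trg g)"
    using assms by (simp del: Comp_Add)
  moreover have "(g \<uplus> neg g) \<cdot> f = g \<cdot> f \<uplus> neg g \<cdot> f"
    using assms by (simp del: arrow_neg(4) add: arrow_neg(1,2,3))
  ultimately have eq': "g \<cdot> f \<uplus> neg g \<cdot> f = Zero C (src f) (trg g)"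
    by simp
  show "neg g \<cdot> f = neg (g \<cdot> f)"
    by (rule neg_unique) (simp_all add: assms eq')
qed

lemma neg_Add_cancel [simp]:
  assumes "arrow f" "arrow g" "src g = src f" "trg g = trg f"
  shows "f \<uplus> (neg f \<uplus> g) = g" "neg f \<uplus> (f \<uplus> g) = g"
  by (simp_all add: Add_assoc[symmetric] assms)

text \<open>
  Together with \<open>difference_Zero\<close> this replaces subtraction: two arrows that agree after a
  composition differ by an arrow that vanishes after it.
\<close>

lemma difference_exists:
  assumes "arr C X Y f" "arr C X Y g"
  shows "\<exists>r. arr C X Y r \<and> f = g \<uplus> r"
  using assms by (intro exI[of _ "neg g \<uplus> f"]) (auto simp: arr_iff)

lemma difference_Zero:
  assumes "arr C X Y f" "arr C X Y r" "f \<uplus> r = f"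
  shows "r = Zero C X Y"
proof -
  have O: "X \<in> Ob C" "Y \<in> Ob C" using assms arr_Ob by auto
  show ?thesis
    by (rule Add_cancel[of f]) (use assms O in \<open>simp_all add: arr_iff\<close>)
qed

end

section \<open>Duality\<close>

definition op_cat :: "('o, 'm, 'x) cat_scheme \<Rightarrow> ('o, 'm) cat" where
  "op_cat C = \<lparr>Ob = Ob C, Hom = (\<lambda>X Y. Hom C Y X), Idt = Idt C, Comp = (\<lambda>g f. f \<cdot>\<^bsub>C\<^esub> g),
               Add = Add C, Zero = (\<lambda>X Y. Zero C Y X)\<rparr>"

lemma op_cat_sel [simp]:
  "Ob (op_cat C) = Ob C" "Hom (op_cat C) X Y = Hom C Y X" "Idt (op_cat C) = Idt C"
  "Comp (op_cat C) g f = Comp C f g" "Add (op_cat C) = Add C" "Zero (op_cat C) X Y = Zero C Y X"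
  by (simp_all add: op_cat_def)

lemma arr_op [simp]: "arr (op_cat C) X Y f = arr C Y X f"
  by (auto simp: arr_def)

lemma hom_group_op [simp]: "hom_group (op_cat C) X Y = hom_group C Y X"
  by (simp add: hom_group_def)

lemma is_zero_object_op [simp]: "is_zero_object (op_cat C) Z = is_zero_object C Z"
  by (auto simp: is_zero_object_def)

lemma is_biproduct_op [simp]:
  "is_biproduct (op_cat C) A B S i1 i2 p1 p2 = is_biproduct C A B S p1 p2 i1 i2"
  by (auto simp: is_biproduct_def)

lemma is_direct_sum_op [simp]: "is_direct_sum (op_cat C) A B S = is_direct_sum C A B S"
  unfolding is_direct_sum_def is_biproduct_op by blast

lemma is_iso_op [simp]: "is_iso (op_cat C) X Y f = is_iso C Y X f"
  by (auto simp: is_iso_def)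

lemma is_mono_op [simp]: "is_mono (op_cat C) X Y f = is_epi C Y X f"
  and is_epi_op [simp]: "is_epi (op_cat C) X Y f = is_mono C Y X f"
  by (auto simp: is_mono_def is_epi_def)

lemma is_kernel_op [simp]: "is_kernel (op_cat C) K X Y k f = is_cokernel C Y X K f k"
  and is_cokernel_op [simp]: "is_cokernel (op_cat C) X Y Q f q = is_kernel C Q Y X q f"
  by (auto simp: is_kernel_def is_cokernel_def)

lemma kernel_cokernel_pair_op [simp]:
  "kernel_cokernel_pair (op_cat C) X Y Z i d = kernel_cokernel_pair C Z Y X d i"
  by (auto simp: kernel_cokernel_pair_def)

lemma is_pullback_op [simp]: "is_pullback (op_cat C) P A B Z p q f g = is_pushout C Z A B P f g p q"
  and is_pushout_op [simp]: "is_pushout (op_cat C) Z A B P f g p q = is_pullback C P A B Z p q f g"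
  by (auto simp: is_pullback_def is_pushout_def)

lemma inflation_op [simp]: "inflation (E\<inverse>) i = deflation E i"
  and deflation_op [simp]: "deflation (E\<inverse>) i = inflation E i"
  by (auto simp: inflation_def deflation_def)

lemma ses_op [simp]: "ses (op_cat C) (E\<inverse>) X Y Z i d = ses C E Z Y X d i"
  by (auto simp: ses_def)

lemma is_additive_subcategory_op [simp]:
  "is_additive_subcategory (op_cat C) S = is_additive_subcategory C S"
  by (auto simp: is_additive_subcategory_def)

lemma closed_under_summands_op [simp]:
  "closed_under_summands (op_cat C) S = closed_under_summands C S"
  by (auto simp: closed_under_summands_def)

lemma B_plus_op [simp]: "B_plus (op_cat C) (E\<inverse>) V U = B_minus C E U V"
  and B_minus_op [simp]: "B_minus (op_cat C) (E\<inverse>) V U = B_plus C E U V"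
  unfolding B_plus_def B_minus_def by auto

lemma (in preadditive_category) preadditive_category_op: "preadditive_category (op_cat C)"
  by (rule preadditive_category.intro)
    (auto intro: arr_Idt arr_Comp Comp_assoc[symmetric] Comp_Idt_left Comp_Idt_right comm_group_hom
      Comp_Add_left Comp_Add_right dest: arr_unique)

lemma (in additive_category) additive_category_op: "additive_category (op_cat C)"
proof -
  interpret op: preadditive_category "op_cat C" by (rule preadditive_category_op)
  show ?thesis
    by standard (auto intro: zero_object_exists direct_sum_exists)
qed

text \<open>
  The two sides bracket the triple composites differently, and associativity reconciles them.
\<close>

lemma (in preadditive_category) is_sum_of_sequences_op:
  assumes "is_sum_of_sequences (op_cat C) X1 Y1 Z1 i1 d1 X2 Y2 Z2 i2 d2 X Y Z i d"
  shows "is_sum_of_sequences C Z1 Y1 X1 d1 i1 Z2 Y2 X2 d2 i2 Z Y X d i"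
proof -
  obtain a1 a2 p1 p2 b1 b2 q1 q2 c1 c2 r1 r2 where
    arrs: "arr C Y1 X1 i1" "arr C Z1 Y1 d1" "arr C Y2 X2 i2" "arr C Z2 Y2 d2" and
    bi: "is_biproduct C X1 X2 X p1 p2 a1 a2" "is_biproduct C Y1 Y2 Y q1 q2 b1 b2"
      "is_biproduct C Z1 Z2 Z r1 r2 c1 c2" and
    i: "i = (p1 \<cdot> (i1 \<cdot> b1)) \<uplus> (p2 \<cdot> (i2 \<cdot> b2))" and
    d: "d = (q1 \<cdot> (d1 \<cdot> c1)) \<uplus> (q2 \<cdot> (d2 \<cdot> c2))"
    using assms unfolding is_sum_of_sequences_def by auto
  have "i = (p1 \<cdot> i1 \<cdot> b1) \<uplus> (p2 \<cdot> i2 \<cdot> b2)" "d = (q1 \<cdot> d1 \<cdot> c1) \<uplus> (q2 \<cdot> d2 \<cdot> c2)"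
    using arrs bi unfolding i d is_biproduct_def by (simp_all add: arr_iff)
  then show ?thesis
    using arrs bi unfolding is_sum_of_sequences_def by blast
qed

lemma (in exact_category) exact_category_op: "exact_category (op_cat C) (E\<inverse>)"
proof -
  interpret op: additive_category "op_cat C" by (rule additive_category_op)
  show ?thesis
  proof
    show "\<exists>X Y Z. kernel_cokernel_pair (op_cat C) X Y Z i d" if "(i, d) \<in> E\<inverse>" for i d
      using that E_kernel_cokernel[of d i] by auto
    show "(i', d') \<in> E\<inverse>" if "ses (op_cat C) (E\<inverse>) X Y Z i d" "arr (op_cat C) X' Y' i'"
      "arr (op_cat C) Y' Z' d'" "is_iso (op_cat C) X X' a" "is_iso (op_cat C) Y Y' b"
      "is_iso (op_cat C) Z Z' c" "b \<cdot>\<^bsub>op_cat C\<^esub> i = i' \<cdot>\<^bsub>op_cat C\<^esub> a" "c \<cdot>\<^bsub>op_cat C\<^esub> d = d' \<cdot>\<^bsub>op_cat C\<^esub> b"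
      for X Y Z i d X' Y' i' Z' d' a b c
    proof -
      note isos = that(4-6)
      obtain a' b' c' where a: "arr C X X' a'" "a' \<cdot> a = Idt C X'" "a \<cdot> a' = Idt C X"
        and b: "arr C Y Y' b'" "b' \<cdot> b = Idt C Y'" "b \<cdot> b' = Idt C Y"
        and c: "arr C Z Z' c'" "c' \<cdot> c = Idt C Z'" "c \<cdot> c' = Idt C Z"
        using isos unfolding is_iso_def by auto
      have arrs: "arr C X' X a" "arr C Y' Y b" "arr C Z' Z c" "arr C Y X i" "arr C Z Y d"
        "arr C Y' X' i'" "arr C Z' Y' d'"
        using that unfolding is_iso_def by (auto simp: ses_def)
      have e: "i \<cdot> b = a \<cdot> i'" "d \<cdot> c = b \<cdot> d'" using that(7,8) by auto
      have "d' \<cdot> c' = (b' \<cdot> b) \<cdot> (d' \<cdot> c')" using arrs a b c by (simp add: arr_iff)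
      also have "\<dots> = b' \<cdot> ((b \<cdot> d') \<cdot> c')" using arrs a(1) b(1) c(1) by (simp add: arr_iff)
      also have "\<dots> = b' \<cdot> (d \<cdot> (c \<cdot> c'))" unfolding e[symmetric] using arrs a(1) b(1) c(1) by (simp add: arr_iff)
      also have "\<dots> = b' \<cdot> d" using arrs b c arr_Ob[OF c(1)] by (simp add: arr_iff)
      finally have 1: "b' \<cdot> d = d' \<cdot> c'" by simp
      have "i' \<cdot> b' = (a' \<cdot> a) \<cdot> (i' \<cdot> b')" using arrs a b c by (simp add: arr_iff)
      also have "\<dots> = a' \<cdot> ((a \<cdot> i') \<cdot> b')" using arrs a(1) b(1) c(1) by (simp add: arr_iff)
      also have "\<dots> = a' \<cdot> (i \<cdot> (b \<cdot> b'))" unfolding e[symmetric] using arrs a(1) b(1) c(1) by (simp add: arr_iff)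
      also have "\<dots> = a' \<cdot> i" using arrs a b arr_Ob[OF c(1)] by (simp add: arr_iff)
      finally have 2: "a' \<cdot> i = i' \<cdot> b'" by simp
      have "is_iso C X X' a'" "is_iso C Y Y' b'" "is_iso C Z Z' c'"
        unfolding is_iso_def using a b c arrs by auto
      then have "(d', i') \<in> E"
        using E_iso_closed[of Z Y X d i Z' Y' d' X' i' c' b' a'] that 1 2 by simp
      then show ?thesis by simp
    qed
    show "(i, d) \<in> E\<inverse>" if "(i1, d1) \<in> E\<inverse>" "(i2, d2) \<in> E\<inverse>"
      "is_sum_of_sequences (op_cat C) X1 Y1 Z1 i1 d1 X2 Y2 Z2 i2 d2 X Y Z i d"
      for i1 d1 i2 d2 X1 Y1 Z1 X2 Y2 Z2 X Y Z i d
      using E_sum_closed[OF _ _ is_sum_of_sequences_op[OF that(3)]] that by auto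
    show "(i1, d1) \<in> E\<inverse> \<and> (i2, d2) \<in> E\<inverse>" if "(i, d) \<in> E\<inverse>"
      "kernel_cokernel_pair (op_cat C) X1 Y1 Z1 i1 d1" "kernel_cokernel_pair (op_cat C) X2 Y2 Z2 i2 d2"
      "is_sum_of_sequences (op_cat C) X1 Y1 Z1 i1 d1 X2 Y2 Z2 i2 d2 X Y Z i d"
      for i1 d1 i2 d2 X1 Y1 Z1 X2 Y2 Z2 X Y Z i d
      using E_summand_closed[OF _ _ _ is_sum_of_sequences_op[OF that(4)]] that by auto
    show "\<exists>Y' i' g'. is_pushout (op_cat C) X Y X' Y' i g g' i' \<and> inflation (E\<inverse>) i'"
      if "arr (op_cat C) X Y i" "inflation (E\<inverse>) i" "arr (op_cat C) X X' g" for X Y i X' g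
      using deflation_pullback[of Y X i X' g] that by simp
    show "\<exists>Y' d' f'. is_pullback (op_cat C) Y' Y Z' Z f' d' d f \<and> deflation (E\<inverse>) d'"
      if "arr (op_cat C) Y Z d" "deflation (E\<inverse>) d" "arr (op_cat C) Z' Z f" for Y Z d Z' f
      using inflation_pushout[of Z Y d Z' f] that by simp
  qed (auto intro: inflation_Idt_zero deflation_Idt_zero inflation_Comp deflation_Comp)
qed

section \<open>Cokernels, pushouts and biproducts\<close>

context preadditive_category
begin

lemma is_cokernelD:
  assumes "is_cokernel C X Y Q f q"
  shows "arr C X Y f" "arr C Y Q q" "q \<cdot> f = Zero C X Q"
    and "\<lbrakk>arr C Y T t; t \<cdot> f = Zero C X T\<rbrakk> \<Longrightarrow> \<exists>u. arr C Q T u \<and> u \<cdot> q = t"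
    and "\<lbrakk>arr C Q T u; arr C Q T u'; u \<cdot> q = u' \<cdot> q\<rbrakk> \<Longrightarrow> u = u'"
proof -
  show a: "arr C X Y f" "arr C Y Q q" "q \<cdot> f = Zero C X Q"
    and "\<lbrakk>arr C Y T t; t \<cdot> f = Zero C X T\<rbrakk> \<Longrightarrow> \<exists>u. arr C Q T u \<and> u \<cdot> q = t"
    using assms unfolding is_cokernel_def by blast+
  assume u: "arr C Q T u" "arr C Q T u'" "u \<cdot> q = u' \<cdot> q"
  have "(u' \<cdot> q) \<cdot> f = u' \<cdot> (q \<cdot> f)" using a(1,2) u(2) by (simp add: arr_iff)
  then have "arr C Y T (u' \<cdot> q)" "(u' \<cdot> q) \<cdot> f = Zero C X T"
    using u a arr_Ob[OF a(1)] by (simp_all add: arr_iff)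
  then show "u = u'"
    using assms u unfolding is_cokernel_def by metis
qed

lemma is_kernelD:
  assumes "is_kernel C K X Y k f"
  shows "arr C K X k" "arr C X Y f" "f \<cdot> k = Zero C K Y"
    and "\<lbrakk>arr C T X t; f \<cdot> t = Zero C T Y\<rbrakk> \<Longrightarrow> \<exists>u. arr C T K u \<and> k \<cdot> u = t"
    and "\<lbrakk>arr C T K u; arr C T K u'; k \<cdot> u = k \<cdot> u'\<rbrakk> \<Longrightarrow> u = u'"
  using preadditive_category.is_cokernelD[OF preadditive_category_op, of Y X K f k] assms by simp_all

lemma is_cokernelI:
  assumes "arr C X Y f" "arr C Y Q q" "q \<cdot> f = Zero C X Q"
    and "\<And>T t. \<lbrakk>arr C Y T t; t \<cdot> f = Zero C X T\<rbrakk> \<Longrightarrow> \<exists>u. arr C Q T u \<and> u \<cdot> q = t"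
    and "\<And>T u u'. \<lbrakk>arr C Q T u; arr C Q T u'; u \<cdot> q = u' \<cdot> q\<rbrakk> \<Longrightarrow> u = u'"
  shows "is_cokernel C X Y Q f q"
  using assms unfolding is_cokernel_def by metis

lemma is_pushoutD:
  assumes "is_pushout C Z A B P f g p q"
  shows "arr C Z A f" "arr C Z B g" "arr C A P p" "arr C B P q" "p \<cdot> f = q \<cdot> g"
    and "\<lbrakk>arr C A T s; arr C B T t; s \<cdot> f = t \<cdot> g\<rbrakk> \<Longrightarrow> \<exists>u. arr C P T u \<and> u \<cdot> p = s \<and> u \<cdot> q = t"
    and "\<lbrakk>arr C P T u; arr C P T u'; u \<cdot> p = u' \<cdot> p; u \<cdot> q = u' \<cdot> q\<rbrakk> \<Longrightarrow> u = u'"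
proof -
  show a: "arr C Z A f" "arr C Z B g" "arr C A P p" "arr C B P q" "p \<cdot> f = q \<cdot> g"
    and "\<lbrakk>arr C A T s; arr C B T t; s \<cdot> f = t \<cdot> g\<rbrakk> \<Longrightarrow> \<exists>u. arr C P T u \<and> u \<cdot> p = s \<and> u \<cdot> q = t"
    using assms unfolding is_pushout_def by blast+
  assume u: "arr C P T u" "arr C P T u'" "u \<cdot> p = u' \<cdot> p" "u \<cdot> q = u' \<cdot> q"
  have "(u' \<cdot> p) \<cdot> f = u' \<cdot> (p \<cdot> f)" "(u' \<cdot> q) \<cdot> g = u' \<cdot> (q \<cdot> g)"
    using a(1-4) u(2) by (simp_all add: arr_iff)
  then have "arr C A T (u' \<cdot> p)" "arr C B T (u' \<cdot> q)" "(u' \<cdot> p) \<cdot> f = (u' \<cdot> q) \<cdot> g"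
    using a u(2) by (simp_all add: arr_iff)
  then show "u = u'"
    using assms u unfolding is_pushout_def by metis
qed

lemma is_pushout_sym: "is_pushout C Z A B P f g p q \<Longrightarrow> is_pushout C Z B A P g f q p"
  unfolding is_pushout_def by metis

lemma is_pushoutI:
  assumes "arr C Z A f" "arr C Z B g" "arr C A P p" "arr C B P q" "p \<cdot> f = q \<cdot> g"
    and "\<And>T s t. \<lbrakk>arr C A T s; arr C B T t; s \<cdot> f = t \<cdot> g\<rbrakk> \<Longrightarrow> \<exists>u. arr C P T u \<and> u \<cdot> p = s \<and> u \<cdot> q = t"
    and "\<And>T u u'. \<lbrakk>arr C P T u; arr C P T u'; u \<cdot> p = u' \<cdot> p; u \<cdot> q = u' \<cdot> q\<rbrakk> \<Longrightarrow> u = u'"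
  shows "is_pushout C Z A B P f g p q"
  using assms unfolding is_pushout_def by metis

lemma is_isoI:
  assumes "arr C X Y f" "arr C Y X g" "g \<cdot> f = Idt C X" "f \<cdot> g = Idt C Y"
  shows "is_iso C X Y f" "is_iso C Y X g"
  using assms unfolding is_iso_def by auto

lemma is_iso_Idt: "X \<in> Ob C \<Longrightarrow> is_iso C X X (Idt C X)"
  by (rule is_isoI[where g = "Idt C X"]) (auto simp: arr_iff)

lemma is_cokernel_unique:
  assumes "is_cokernel C X Y Q f q" "is_cokernel C X Y Q' f q'"
  shows "\<exists>u. is_iso C Q Q' u \<and> u \<cdot> q = q'"
proof -
  note D = is_cokernelD[OF assms(1)] and D' = is_cokernelD[OF assms(2)]
  obtain u where u: "arr C Q Q' u" "u \<cdot> q = q'" using D(4)[OF D'(2,3)] by blast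
  obtain v where v: "arr C Q' Q v" "v \<cdot> q' = q" using D'(4)[OF D(2,3)] by blast
  have Ob: "Q \<in> Ob C" "Q' \<in> Ob C" using u arr_Ob by auto
  have "(v \<cdot> u) \<cdot> q = v \<cdot> (u \<cdot> q)" "(u \<cdot> v) \<cdot> q' = u \<cdot> (v \<cdot> q')"
    using u(1) v(1) D(2) D'(2) by (simp_all add: arr_iff)
  then have "v \<cdot> u = Idt C Q" and "u \<cdot> v = Idt C Q'"
    using u v D(2) D'(2) Ob D(5)[of Q "v \<cdot> u" "Idt C Q"] D'(5)[of Q' "u \<cdot> v" "Idt C Q'"]
    by (simp_all add: arr_iff)
  then show ?thesis using is_isoI(1)[OF u(1) v(1)] u(2) by blast
qed

lemma is_pushout_unique:
  assumes "is_pushout C Z A B P f g p q" "is_pushout C Z A B P' f g p' q'"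
  shows "\<exists>u. is_iso C P P' u \<and> u \<cdot> p = p' \<and> u \<cdot> q = q'"
proof -
  note D = is_pushoutD[OF assms(1)] and D' = is_pushoutD[OF assms(2)]
  obtain u where u: "arr C P P' u" "u \<cdot> p = p'" "u \<cdot> q = q'" using D(6)[OF D'(3,4,5)] by blast
  obtain v where v: "arr C P' P v" "v \<cdot> p' = p" "v \<cdot> q' = q" using D'(6)[OF D(3,4,5)] by blast
  have Ob: "P \<in> Ob C" "P' \<in> Ob C" using u arr_Ob by auto
  have "(v \<cdot> u) \<cdot> p = v \<cdot> (u \<cdot> p)" "(u \<cdot> v) \<cdot> p' = u \<cdot> (v \<cdot> p')"
    "(v \<cdot> u) \<cdot> q = v \<cdot> (u \<cdot> q)" "(u \<cdot> v) \<cdot> q' = u \<cdot> (v \<cdot> q')"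
    using u(1) v(1) D(3,4) D'(3,4) by (simp_all add: arr_iff)
  then have "v \<cdot> u = Idt C P" "u \<cdot> v = Idt C P'"
    using u v D(3,4) D'(3,4) Ob D(7)[of P "v \<cdot> u" "Idt C P"] D'(7)[of P' "u \<cdot> v" "Idt C P'"]
    by (simp_all add: arr_iff)
  then show ?thesis using is_isoI(1)[OF u(1) v(1)] u(2,3) by blast
qed

text \<open>
  An arrow on the pushout that kills \<open>i'\<close> is determined by its restriction along \<open>g'\<close>, which kills
  \<open>i\<close>; so both cokernels represent the same functor.
\<close>

lemma pushout_cokernel:
  assumes po: "is_pushout C X Y X' P i g g' i'" and co: "is_cokernel C X Y Z i d"
  shows "\<exists>d'. is_cokernel C X' P Z i' d' \<and> d' \<cdot> g' = d"
proof -
  note P = is_pushoutD[OF po] and D = is_cokernelD[OF co]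
  have Ob: "X \<in> Ob C" "Y \<in> Ob C" "Z \<in> Ob C" "X' \<in> Ob C" using P(1,2) D(2) arr_Ob by blast+
  have "d \<cdot> i = Zero C X' Z \<cdot> g" using D(3) P(2) Ob by (simp add: arr_iff)
  then obtain d' where d': "arr C P Z d'" "d' \<cdot> g' = d" "d' \<cdot> i' = Zero C X' Z"
    using P(6)[of Z d "Zero C X' Z"] D(2) Ob by (auto simp: arr_iff)
  have "is_cokernel C X' P Z i' d'"
  proof (rule is_cokernelI[OF P(4) d'(1,3)])
    fix T t assume t: "arr C P T t" "t \<cdot> i' = Zero C X' T"
    have T: "T \<in> Ob C" using t arr_Ob by blast
    have tg: "arr C Y T (t \<cdot> g')" using t(1) P(3) by (simp add: arr_iff)
    have "(t \<cdot> g') \<cdot> i = (t \<cdot> i') \<cdot> g" using t(1) P(1-5) by (simp add: arr_iff)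
    also have "\<dots> = Zero C X T" using t P(2) T by (simp add: arr_iff)
    finally obtain u where u: "arr C Z T u" "u \<cdot> d = t \<cdot> g'" using D(4)[OF tg] by blast
    have "(u \<cdot> d') \<cdot> g' = u \<cdot> (d' \<cdot> g')" "(u \<cdot> d') \<cdot> i' = u \<cdot> (d' \<cdot> i')"
      using u(1) d'(1) P(3,4) by (simp_all add: arr_iff)
    then have "u \<cdot> d' = t"
      using u t d' Ob P(7)[of T "u \<cdot> d'" t] by (simp add: arr_iff)
    then show "\<exists>u. arr C Z T u \<and> u \<cdot> d' = t" using u(1) by blast
  next
    fix T u u' assume u: "arr C Z T u" "arr C Z T u'" "u \<cdot> d' = u' \<cdot> d'"
    have "u \<cdot> (d' \<cdot> g') = (u \<cdot> d') \<cdot> g'" "u' \<cdot> (d' \<cdot> g') = (u' \<cdot> d') \<cdot> g'"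
      using u(1,2) d'(1) P(3) by (simp_all add: arr_iff)
    then show "u = u'" using u d'(2) D(5)[of T u u'] by simp
  qed
  then show ?thesis using d'(2) by blast
qed

lemma biproductD:
  assumes "is_biproduct C A B S i1 i2 p1 p2"
  shows "arr C A S i1" "arr C B S i2" "arr C S A p1" "arr C S B p2"
    "p1 \<cdot> i1 = Idt C A" "p2 \<cdot> i2 = Idt C B" "p2 \<cdot> i1 = Zero C A B" "p1 \<cdot> i2 = Zero C B A"
    "(i1 \<cdot> p1) \<uplus> (i2 \<cdot> p2) = Idt C S"
  using assms unfolding is_biproduct_def by blast+

lemma biproduct_Comp:
  assumes b: "is_biproduct C A B S i1 i2 p1 p2"
  shows "arr C X A f \<Longrightarrow> p1 \<cdot> (i1 \<cdot> f) = f" "arr C X A f \<Longrightarrow> p2 \<cdot> (i1 \<cdot> f) = Zero C X B"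
    and "arr C X B g \<Longrightarrow> p2 \<cdot> (i2 \<cdot> g) = g" "arr C X B g \<Longrightarrow> p1 \<cdot> (i2 \<cdot> g) = Zero C X A"
proof -
  note D = biproductD[OF b]
  have O: "A \<in> Ob C" "B \<in> Ob C" using arr_Ob[OF D(1)] arr_Ob[OF D(2)] by auto
  show "p1 \<cdot> (i1 \<cdot> f) = f" "p2 \<cdot> (i1 \<cdot> f) = Zero C X B" if f: "arr C X A f"
    using Comp_assoc[OF f D(1,3)] Comp_assoc[OF f D(1,4)] f O unfolding D(5,7)
    by (simp_all add: arr_iff)
  show "p2 \<cdot> (i2 \<cdot> g) = g" "p1 \<cdot> (i2 \<cdot> g) = Zero C X A" if g: "arr C X B g"
    using Comp_assoc[OF g D(2,3)] Comp_assoc[OF g D(2,4)] g O unfolding D(6,8)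
    by (simp_all add: arr_iff)
qed

lemma biproduct_sym:
  assumes "is_biproduct C A B S i1 i2 p1 p2"
  shows "is_biproduct C B A S i2 i1 p2 p1"
  using assms unfolding is_biproduct_def by (auto simp: arr_iff Add_commute)

lemma biproduct_zero:
  assumes "A \<in> Ob C" "is_zero_object C z"
  shows "is_biproduct C A z A (Idt C A) (Zero C z A) (Idt C A) (Zero C A z)"
proof -
  have "z \<in> Ob C" "Zero C z z = Idt C z" using assms unfolding is_zero_object_def
    by (auto simp: arr_iff)
  then show ?thesis using assms unfolding is_biproduct_def by (simp add: arr_iff)
qed

end

section \<open>Short exact sequences\<close>

context exact_category
begin

lemma sesD:
  assumes "ses C E X Y Z i d"
  shows "arr C X Y i" "arr C Y Z d" "is_kernel C X Y Z i d" "is_cokernel C X Y Z i d"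
    "inflation E i" "deflation E d" "X \<in> Ob C" "Y \<in> Ob C" "Z \<in> Ob C"
proof -
  show a: "arr C X Y i" "arr C Y Z d" "inflation E i" "deflation E d"
    using assms unfolding ses_def inflation_def deflation_def by auto
  then show "X \<in> Ob C" "Y \<in> Ob C" "Z \<in> Ob C" using arr_Ob by blast+
  obtain X' Y' Z' where k: "kernel_cokernel_pair C X' Y' Z' i d"
    using assms E_kernel_cokernel unfolding ses_def by blast
  then have "arr C X' Y' i" "arr C Y' Z' d"
    unfolding kernel_cokernel_pair_def is_kernel_def by auto
  then have "X' = X" "Y' = Y" "Z' = Z" using a arr_unique by metis+
  then show "is_kernel C X Y Z i d" "is_cokernel C X Y Z i d"
    using k unfolding kernel_cokernel_pair_def by auto
qed

lemma inflation_ses: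
  assumes "arr C X Y i" "inflation E i"
  shows "\<exists>Z d. ses C E X Y Z i d"
proof -
  obtain d where d: "(i, d) \<in> E" using assms unfolding inflation_def by blast
  then obtain X' Y' Z where "kernel_cokernel_pair C X' Y' Z i d" using E_kernel_cokernel by blast
  then have "arr C X' Y' i" "arr C Y' Z d"
    unfolding kernel_cokernel_pair_def is_kernel_def by auto
  then show ?thesis using assms d arr_unique unfolding ses_def by metis
qed

text \<open>
  An inflation has one cokernel in \<open>E\<close>, and \<open>E\<close> is closed under isomorphism. This lemma reduces
  exactness of a sequence to a universal property once its first arrow is known to be an inflation.
\<close>

lemma ses_of_cokernel:
  assumes "inflation E i" "is_cokernel C X Y Q i q"
  shows "ses C E X Y Q i q"
proof -
  note Q = is_cokernelD(1,2)[OF assms(2)]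
  obtain Z d where s: "ses C E X Y Z i d" using inflation_ses Q assms(1) by blast
  obtain u where u: "is_iso C Z Q u" "u \<cdot> d = q"
    using is_cokernel_unique[OF sesD(4)[OF s] assms(2)] by blast
  have "(i, q) \<in> E"
    using E_iso_closed[OF s Q is_iso_Idt is_iso_Idt u(1)] Q u(2) arr_Ob[OF Q(1)]
    by (simp add: arr_iff)
  then show ?thesis using Q unfolding ses_def by blast
qed

lemma inflation_iso:
  assumes "arr C X Y i" "inflation E i" "is_iso C Y Y' b"
  shows "inflation E (b \<cdot> i)"
proof -
  obtain Z d where s: "ses C E X Y Z i d" using inflation_ses assms by blast
  note S = sesD[OF s]
  obtain b' where b: "arr C Y Y' b" "arr C Y' Y b'" "b' \<cdot> b = Idt C Y"
    using assms(3) unfolding is_iso_def by blast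
  have "(b \<cdot> i, d \<cdot> b') \<in> E"
  proof (rule E_iso_closed[OF s])
    show "arr C X Y' (b \<cdot> i)" "arr C Y' Z (d \<cdot> b')" using b S(1,2) by (simp_all add: arr_iff)
    show "is_iso C X X (Idt C X)" "is_iso C Z Z (Idt C Z)" "is_iso C Y Y' b"
      using is_iso_Idt S(7,9) assms(3) by auto
    show "b \<cdot> i = b \<cdot> i \<cdot> Idt C X" using b S by (simp add: arr_iff)
    show "Idt C Z \<cdot> d = d \<cdot> b' \<cdot> b" using b S by (simp add: arr_iff)
  qed
  then show ?thesis unfolding inflation_def by blast
qed

text \<open>
  The axioms supply one pushout that is an inflation; every other pushout is isomorphic to it.
\<close>

lemma pushout_ses:
  assumes po: "is_pushout C X Y X' P i g g' i'" and s: "ses C E X Y Z i d"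
  shows "\<exists>d'. ses C E X' P Z i' d' \<and> d' \<cdot> g' = d"
proof -
  note P = is_pushoutD[OF po] and S = sesD[OF s]
  obtain P2 i2 g2 where 2: "is_pushout C X Y X' P2 i g g2 i2" "inflation E i2"
    using inflation_pushout[OF S(1,5) P(2)] by blast
  obtain u where u: "is_iso C P2 P u" "u \<cdot> i2 = i'" using is_pushout_unique[OF 2(1) po] by blast
  have "inflation E i'" using inflation_iso[OF is_pushoutD(4)[OF 2(1)] 2(2) u(1)] unfolding u(2) .
  moreover obtain d' where "is_cokernel C X' P Z i' d'" "d' \<cdot> g' = d"
    using pushout_cokernel[OF po S(4)] by blast
  ultimately show ?thesis using ses_of_cokernel by blast
qed

lemma zero_object_arr:
  assumes "is_zero_object C z"
  shows "arr C X z f \<Longrightarrow> f = Zero C X z" "arr C z X f \<Longrightarrow> f = Zero C z X"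
    "Zero C z z = Idt C z" "z \<in> Ob C"
proof -
  show z: "z \<in> Ob C" using assms unfolding is_zero_object_def by simp
  have u: "f = g" if "arr C X z f" "arr C X z g" for X f g
  proof -
    have "X \<in> Ob C" using arr_Ob[OF that(1)] by simp
    then have "\<exists>!f. arr C X z f" using assms unfolding is_zero_object_def by simp
    then show ?thesis using that by metis
  qed
  have v: "f = g" if "arr C z X f" "arr C z X g" for X f g
  proof -
    have "X \<in> Ob C" using arr_Ob[OF that(1)] by simp
    then have "\<exists>!f. arr C z X f" using assms unfolding is_zero_object_def by simp
    then show ?thesis using that by metis
  qed
  have Zero: "arr C X Y (Zero C X Y)" if "X \<in> Ob C" "Y \<in> Ob C" for X Y
    using that by (simp add: arr_iff)
  show "Zero C z z = Idt C z" using u[OF Zero arr_Idt] z by blast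
  show "f = Zero C X z" if "arr C X z f" for X f
    using u[OF that Zero] arr_Ob[OF that] by blast
  show "f = Zero C z X" if "arr C z X f" for X f
    using v[OF that Zero] arr_Ob[OF that] by blast
qed

text \<open>
  A pushout of the identity of a zero object \<open>z\<close> along \<open>z \<rightarrow> A\<close> is an isomorphism with source \<open>A\<close>.
\<close>

lemma inflation_Idt:
  assumes A: "A \<in> Ob C"
  shows "inflation E (Idt C A)"
proof -
  obtain z where z: "is_zero_object C z" using zero_object_exists by blast
  note zO = zero_object_arr(4)[OF z]
  obtain P i' g where po: "is_pushout C z z A P (Idt C z) (Zero C z A) g i'" and i': "inflation E i'"
    using inflation_pushout[of z z "Idt C z" A "Zero C z A"] inflation_Idt_zero[OF z] zO A
    by (auto simp: arr_iff)
  note P = is_pushoutD[OF po]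
  obtain r where r: "arr C P A r" "r \<cdot> i' = Idt C A"
    using P(6)[of A "Zero C z A" "Idt C A"] zO A by (auto simp: arr_iff)
  have "is_iso C P A r"
  proof (rule is_isoI(2)[OF P(4) r])
    have "arr C z P ((i' \<cdot> r) \<cdot> g)" "arr C z P (Idt C P \<cdot> g)"
      using r(1) P(3,4) arr_Ob[OF P(4)] by (simp_all add: arr_iff)
    then have "(i' \<cdot> r) \<cdot> g = Idt C P \<cdot> g"
      using zero_object_arr(2)[OF z, of P] by metis
    moreover have "(i' \<cdot> r) \<cdot> i' = i' \<cdot> (r \<cdot> i')" using r(1) P(4) by (simp add: arr_iff)
    then have "(i' \<cdot> r) \<cdot> i' = Idt C P \<cdot> i'" using r(2) P(4) by (simp add: arr_iff)
    moreover have "arr C P P (i' \<cdot> r)" "arr C P P (Idt C P)"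
      using r(1) P(4) arr_Ob[OF P(4)] by (simp_all add: arr_iff)
    ultimately show "i' \<cdot> r = Idt C P" by (intro P(7)[of P "i' \<cdot> r" "Idt C P"])
  qed
  then show ?thesis using inflation_iso[OF P(4) i'] r(2) by fastforce
qed

lemma ses_Idt_Zero:
  assumes A: "A \<in> Ob C" and z: "is_zero_object C z"
  shows "ses C E A A z (Idt C A) (Zero C A z)"
proof (rule ses_of_cokernel[OF inflation_Idt[OF A]])
  note zO = zero_object_arr(4)[OF z]
  show "is_cokernel C A A z (Idt C A) (Zero C A z)"
  proof (rule is_cokernelI)
    show "\<exists>u. arr C z T u \<and> u \<cdot> Zero C A z = t" if "arr C A T t" "t \<cdot> Idt C A = Zero C A T" for T t
      using that zO A arr_Ob[OF that(1)] by (intro exI[of _ "Zero C z T"]) (simp add: arr_iff)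
    show "u = u'" if "arr C z T u" "arr C z T u'" for T u u'
      using that zero_object_arr(2)[OF z] by metis
  qed (use A zO in \<open>simp_all add: arr_iff\<close>)
qed

lemma ses_Zero_Idt:
  assumes "A \<in> Ob C" "is_zero_object C z"
  shows "ses C E z A A (Zero C z A) (Idt C A)"
  using exact_category.ses_Idt_Zero[OF exact_category_op, of A z] assms by simp

lemma ses_sum:
  assumes s1: "ses C E X1 Y1 Z1 i1 d1" and s2: "ses C E X2 Y2 Z2 i2 d2"
    and b: "is_biproduct C X1 X2 X a1 a2 p1 p2" "is_biproduct C Y1 Y2 Y b1 b2 q1 q2"
      "is_biproduct C Z1 Z2 Z c1 c2 r1 r2"
  shows "ses C E X Y Z (b1 \<cdot> i1 \<cdot> p1 \<uplus> b2 \<cdot> i2 \<cdot> p2) (c1 \<cdot> d1 \<cdot> q1 \<uplus> c2 \<cdot> d2 \<cdot> q2)"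
proof -
  note S1 = sesD[OF s1] and S2 = sesD[OF s2]
  have "is_sum_of_sequences C X1 Y1 Z1 i1 d1 X2 Y2 Z2 i2 d2 X Y Z
      (b1 \<cdot> i1 \<cdot> p1 \<uplus> b2 \<cdot> i2 \<cdot> p2) (c1 \<cdot> d1 \<cdot> q1 \<uplus> c2 \<cdot> d2 \<cdot> q2)"
    unfolding is_sum_of_sequences_def using S1 S2 b by blast
  then have "(b1 \<cdot> i1 \<cdot> p1 \<uplus> b2 \<cdot> i2 \<cdot> p2, c1 \<cdot> d1 \<cdot> q1 \<uplus> c2 \<cdot> d2 \<cdot> q2) \<in> E"
    using E_sum_closed s1 s2 unfolding ses_def by blast
  then show ?thesis
    using S1(1,2) S2(1,2) biproductD(1-4)[OF b(1)] biproductD(1-4)[OF b(2)] biproductD(1-4)[OF b(3)]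
    unfolding ses_def by (simp add: arr_iff)
qed

text \<open>
  A split sequence is the sum of the trivial sequences \<open>A \<rightarrow> A \<rightarrow> 0\<close> and \<open>0 \<rightarrow> B \<rightarrow> B\<close>.
\<close>

lemma ses_split:
  assumes b: "is_biproduct C A B S i1 i2 p1 p2"
  shows "ses C E A S B i1 p2"
proof -
  note D = biproductD(1-4)[OF b]
  have O: "A \<in> Ob C" "B \<in> Ob C" "S \<in> Ob C" using D arr_Ob by auto
  obtain z where z: "is_zero_object C z" using zero_object_exists by blast
  note zO = zero_object_arr(4)[OF z]
  have "ses C E A S B (i1 \<cdot> Idt C A \<cdot> Idt C A \<uplus> i2 \<cdot> Zero C z B \<cdot> Zero C A z)
     (Zero C z B \<cdot> Zero C A z \<cdot> p1 \<uplus> Idt C B \<cdot> Idt C B \<cdot> p2)"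
    by (rule ses_sum[OF ses_Idt_Zero[OF O(1) z] ses_Zero_Idt[OF O(2) z]
        biproduct_zero[OF O(1) z] b biproduct_sym[OF biproduct_zero[OF O(2) z]]])
  then show ?thesis using D O zO by (simp add: arr_iff)
qed

text \<open>
  The idempotent \<open>1 - t d\<close> is killed by \<open>d\<close>, so it factors through the kernel \<open>i\<close>; the factor is the
  missing retraction.
\<close>

lemma split_of_section:
  assumes s: "ses C E X Y Z i d" and t: "arr C Z Y t" "d \<cdot> t = Idt C Z"
  shows "\<exists>r. is_biproduct C X Z Y i t r d"
proof -
  note S = sesD[OF s] and K = is_kernelD[OF sesD(3)[OF s]]
  define e where "e = Idt C Y \<uplus> neg (t \<cdot> d)"
  have e: "arr C Y Y e" unfolding e_def using S t by (simp add: arr_iff)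
  have dtd: "d \<cdot> (t \<cdot> d) = d" using S t Comp_assoc[OF S(2) t(1) S(2)] by (simp add: arr_iff)
  then have "d \<cdot> e = Zero C Y Z" unfolding e_def using S t dtd by (simp add: arr_iff)
  then obtain r where r: "arr C Y X r" "i \<cdot> r = e" using K(4) e by blast
  have et: "e \<cdot> t = Zero C Z Y" unfolding e_def using S t by (simp add: arr_iff)
  have ei: "e \<cdot> i = i" unfolding e_def using S t K(3) by (simp add: arr_iff)
  have "i \<cdot> (r \<cdot> i) = i \<cdot> Idt C X" using S(1,7) r ei Comp_assoc[OF S(1) r(1) S(1)] by (simp add: arr_iff)
  then have ri: "r \<cdot> i = Idt C X" using S(1,7) r(1) K(5)[of X "r \<cdot> i" "Idt C X"] by (simp add: arr_iff)
  have "i \<cdot> (r \<cdot> t) = i \<cdot> Zero C Z X" using S(1,7,9) r et t Comp_assoc[OF t(1) r(1) S(1)] by (simp add: arr_iff)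
  then have rt: "r \<cdot> t = Zero C Z X" using S(1,7,9) r(1) t(1) K(5)[of Z "r \<cdot> t" "Zero C Z X"] by (simp add: arr_iff)
  have "i \<cdot> r \<uplus> t \<cdot> d = Idt C Y" unfolding r(2) e_def using S t by (simp add: arr_iff Add_assoc)
  then show ?thesis
    unfolding is_biproduct_def using S t r ri rt K(3) by blast
qed

lemma split_of_retraction:
  assumes s: "ses C E X Y Z i d" and r: "arr C Y X r" "r \<cdot> i = Idt C X"
  shows "\<exists>t. is_biproduct C X Z Y i t r d"
  using exact_category.split_of_section[OF exact_category_op, of Z Y X d i r] assms
  by (auto dest: biproduct_sym)

text \<open>
  The third isomorphism theorem. An arrow on \<open>Y\<close> that vanishes on \<open>A\<close> induces an arrow on \<open>Z = B/A\<close>, so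
  the pushout of \<open>j\<close> along \<open>d\<close> is a cokernel of \<open>j \<cdot> i\<close>; by \<open>pushout_ses\<close> it also has the same cokernel
  over \<open>Z\<close> as \<open>j\<close> has.
\<close>

lemma ses_Comp_inflation:
  assumes s1: "ses C E A B Z i d" and s2: "ses C E B Y T j e"
  shows "\<exists>Q p q e'. ses C E A Y Q (j \<cdot> i) p \<and> ses C E Z Q T q e' \<and> e' \<cdot> p = e \<and> p \<cdot> j = q \<cdot> d"
proof -
  note S1 = sesD[OF s1] and S2 = sesD[OF s2]
  note K1 = is_cokernelD[OF S1(4)]
  obtain Q q p where po: "is_pushout C B Y Z Q j d p q"
    using inflation_pushout[OF S2(1,5) S1(2)] by blast
  note P = is_pushoutD[OF po]
  obtain e' where e': "ses C E Z Q T q e'" "e' \<cdot> p = e" using pushout_ses[OF po s2] by blast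
  have "is_cokernel C A Y Q (j \<cdot> i) p"
  proof (rule is_cokernelI)
    show "arr C A Y (j \<cdot> i)" "arr C Y Q p" using S1(1) S2(1) P(3) by (simp_all add: arr_iff)
    have "p \<cdot> (j \<cdot> i) = q \<cdot> (d \<cdot> i)"
      using S1(1,2) S2(1) P(3-5) Comp_assoc[OF S1(1) S2(1) P(3)] by (simp add: arr_iff)
    also have "\<dots> = Zero C A Q" using K1(3) P(4) S1(7) by (simp add: arr_iff)
    finally show "p \<cdot> (j \<cdot> i) = Zero C A Q" .
    show "\<exists>u. arr C Q X u \<and> u \<cdot> p = t" if t: "arr C Y X t" "t \<cdot> (j \<cdot> i) = Zero C A X" for X t
    proof -
      have "arr C B X (t \<cdot> j)" "(t \<cdot> j) \<cdot> i = Zero C A X"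
        using t S1(1) S2(1) by (simp_all add: arr_iff)
      then obtain s where "arr C Z X s" "s \<cdot> d = t \<cdot> j" using K1(4) by blast
      then show ?thesis using P(6)[OF t(1), of s] by auto
    qed
    show "u = u'" if u: "arr C Q X u" "arr C Q X u'" "u \<cdot> p = u' \<cdot> p" for X u u'
    proof (rule P(7)[OF u])
      have "(u \<cdot> q) \<cdot> d = (u \<cdot> p) \<cdot> j" "(u' \<cdot> q) \<cdot> d = (u' \<cdot> p) \<cdot> j"
        using u(1,2) P(3-5) S1(2) S2(1) by (simp_all add: arr_iff)
      then show "u \<cdot> q = u' \<cdot> q"
        using u P(4) K1(5)[of X "u \<cdot> q" "u' \<cdot> q"] by (simp add: arr_iff)
    qed
  qed
  moreover have "inflation E (j \<cdot> i)" using inflation_Comp S1 S2 by blast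
  ultimately show ?thesis using ses_of_cokernel e' P(5) by blast
qed

lemma ses_Comp_deflation:
  assumes s1: "ses C E V Y B v d" and s2: "ses C E A B U f e"
  shows "\<exists>K k p v'. ses C E K Y U k (e \<cdot> d) \<and> ses C E V K A v' p \<and> k \<cdot> v' = v \<and> d \<cdot> k = f \<cdot> p"
proof -
  have "\<exists>Q p q e'. ses C E Q Y U p (e \<cdot> d) \<and> ses C E V Q A e' q \<and> p \<cdot> e' = v \<and> d \<cdot> p = f \<cdot> q"
    using exact_category.ses_Comp_inflation[OF exact_category_op, of U B A e f Y V d v] assms by simp
  then show ?thesis by blast
qed

text \<open>
  For an inflation \<open>j\<close> the map \<open>(f, j)\<close> is the composite of the split inflation \<open>(f, 1)\<close> with \<open>1 \<oplus> j\<close>,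
  and a pushout of \<open>j\<close> along \<open>f\<close> is a cokernel of it.
\<close>

lemma pushout_ses_biproduct:
  assumes s: "ses C E A W U j e" and f: "arr C A B f" and po: "is_pushout C A W B P j f h c"
    and b: "is_biproduct C B W S b1 b2 q1 q2"
  shows "ses C E A S P (b1 \<cdot> f \<uplus> b2 \<cdot> j) (c \<cdot> q1 \<uplus> neg (h \<cdot> q2))"
proof -
  note S = sesD[OF s] and P = is_pushoutD[OF po] and b' = biproductD[OF b]
  have O: "B \<in> Ob C" "S \<in> Ob C" "P \<in> Ob C" using arr_Ob[OF f] arr_Ob[OF b'(1)] arr_Ob[OF P(3)] by auto
  obtain z where z: "is_zero_object C z" using zero_object_exists by blast
  note zO = zero_object_arr(4)[OF z]
  obtain S0 a1 a2 p1 p2 where a: "is_biproduct C B A S0 a1 a2 p1 p2"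
    using direct_sum_exists[OF O(1) S(7)] unfolding is_direct_sum_def by blast
  note a' = biproductD[OF a]
  have S0: "S0 \<in> Ob C" using arr_Ob[OF a'(1)] by auto
  define m where "m = b1 \<cdot> p1 \<uplus> b2 \<cdot> (j \<cdot> p2)"
  have m: "arr C S0 S m" unfolding m_def using a' b' S by (simp add: arr_iff)
  have "ses C E S0 S U (b1 \<cdot> Idt C B \<cdot> p1 \<uplus> b2 \<cdot> j \<cdot> p2) (Zero C z U \<cdot> Zero C B z \<cdot> q1 \<uplus> Idt C U \<cdot> e \<cdot> q2)"
    by (rule ses_sum[OF ses_Idt_Zero[OF O(1) z] s a b biproduct_sym[OF biproduct_zero[OF S(9) z]]])
  then have "ses C E S0 S U m (e \<cdot> q2)"
    using a'(1-4) b'(1-4) S zO O unfolding m_def by (simp add: arr_iff)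
  then have mi: "inflation E m" by (rule sesD)
  define n where "n = a1 \<cdot> f \<uplus> a2"
  have n: "arr C A S0 n" unfolding n_def using a' f by (simp add: arr_iff)
  have p1n: "p1 \<cdot> n = f" and p2n: "p2 \<cdot> n = Idt C A"
    using a' f S(7) O biproduct_Comp(1,2)[OF a f] unfolding n_def by (simp_all add: arr_iff)
  \<comment> \<open>The graph of \<open>f\<close> is a complement of \<open>B\<close> in \<open>B \<oplus> A\<close>.\<close>
  have "is_biproduct C A B S0 n a1 p2 (p1 \<uplus> neg (f \<cdot> p2))"
  proof -
    have 1: "(p1 \<uplus> neg (f \<cdot> p2)) \<cdot> n = Zero C A B"
      using a'(1-4) f n p1n p2n by (simp add: arr_iff)
    have 2: "(p1 \<uplus> neg (f \<cdot> p2)) \<cdot> a1 = Idt C B" 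
      using a'(1-8) f S O by (simp add: arr_iff)
    have "n \<cdot> p2 \<uplus> a1 \<cdot> (p1 \<uplus> neg (f \<cdot> p2)) = a1 \<cdot> (f \<cdot> p2) \<uplus> (a2 \<cdot> p2 \<uplus> (a1 \<cdot> p1 \<uplus> neg (a1 \<cdot> (f \<cdot> p2))))"
      using a'(1-4) f unfolding n_def by (simp add: arr_iff Add_assoc)
    also have "\<dots> = (a1 \<cdot> (f \<cdot> p2) \<uplus> neg (a1 \<cdot> (f \<cdot> p2))) \<uplus> (a1 \<cdot> p1 \<uplus> a2 \<cdot> p2)"
      using a'(1-4) f by (simp del: arrow_neg(4,5) neg_Add_cancel add: arr_iff Add_ac)
    also have "\<dots> = Idt C S0"
      using a' f S0 by (simp add: arr_iff)
    finally show ?thesis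
      unfolding is_biproduct_def using 1 2 n p2n a' f by (auto simp: arr_iff)
  qed
  then have ni: "inflation E n" using ses_split sesD(5) by blast
  define k where "k = b1 \<cdot> f \<uplus> b2 \<cdot> j"
  have k: "arr C A S k" unfolding k_def using b' f S by (simp add: arr_iff)
  have q1k: "q1 \<cdot> k = f" and q2k: "q2 \<cdot> k = j"
    using b'(1-4) f S O biproduct_Comp(1,2)[OF b f] biproduct_Comp(3,4)[OF b S(1)] unfolding k_def
    by (simp_all add: arr_iff)
  have "m \<cdot> n = k"
    using p1n p2n a'(1-4) b'(1-4) S n f unfolding m_def k_def by (simp add: arr_iff)
  then have ki: "inflation E k" using inflation_Comp[OF n m ni mi] by simp
  define g where "g = c \<cdot> q1 \<uplus> neg (h \<cdot> q2)"
  have g: "arr C S P g" unfolding g_def using b' P by (simp add: arr_iff)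
  have gb1: "g \<cdot> b1 = c" and gb2: "g \<cdot> b2 = neg h"
    using b' P(1-4) O S(7,8) unfolding g_def by (simp_all add: arr_iff)
  have "is_cokernel C A S P k g"
  proof (rule is_cokernelI[OF k g])
    have "g \<cdot> k = c \<cdot> (q1 \<cdot> k) \<uplus> neg (h \<cdot> (q2 \<cdot> k))"
      unfolding g_def using b'(1-4) P(1-4) k by (simp add: arr_iff)
    also have "\<dots> = Zero C A P" unfolding q1k q2k using P by (simp add: arr_iff)
    finally show "g \<cdot> k = Zero C A P" .
    fix T
    show "\<exists>u. arr C P T u \<and> u \<cdot> g = t" if t: "arr C S T t" "t \<cdot> k = Zero C A T" for t
    proof -
      have T: "T \<in> Ob C" using t arr_Ob by blast
      have "(t \<cdot> b1) \<cdot> f \<uplus> (t \<cdot> b2) \<cdot> j = Zero C A T"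
        using t(2) b' t(1) f S unfolding k_def by (simp add: arr_iff)
      then have "t \<cdot> b2 \<cdot> j = neg (t \<cdot> b1 \<cdot> f)"
        using b'(1-4) t(1) f S neg_unique[of "t \<cdot> b1 \<cdot> f" "t \<cdot> b2 \<cdot> j"] by (simp add: arr_iff)
      then have "t \<cdot> b2 \<cdot> j = neg (t \<cdot> b1) \<cdot> f"
        using b'(1-4) t(1) f S by (simp add: arr_iff)
      then have *: "neg (t \<cdot> b2) \<cdot> j = t \<cdot> b1 \<cdot> f"
        using b'(1-4) t(1) f S neg_unique[of "neg (t \<cdot> b1 \<cdot> f)" "t \<cdot> b1 \<cdot> f"] by (simp add: arr_iff)
      obtain u where u: "arr C P T u" "u \<cdot> h = neg (t \<cdot> b2)" "u \<cdot> c = t \<cdot> b1"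
        using P(6)[OF _ _ *] b'(1-4) t(1) by (auto simp: arr_iff)
      have "u \<cdot> g = (u \<cdot> c) \<cdot> q1 \<uplus> neg (u \<cdot> h) \<cdot> q2"
        unfolding g_def using u(1) P(1-4) b'(1-4) by (simp add: arr_iff)
      also have "neg (u \<cdot> h) = t \<cdot> b2"
        unfolding u(2) using b'(1-4) t(1) neg_unique[of "neg (t \<cdot> b2)" "t \<cdot> b2"] by (simp add: arr_iff)
      also have "(u \<cdot> c) \<cdot> q1 \<uplus> t \<cdot> b2 \<cdot> q2 = t \<cdot> (b1 \<cdot> q1 \<uplus> b2 \<cdot> q2)"
        unfolding u(3) using b'(1-4) t(1) by (simp add: arr_iff)
      also have "\<dots> = t" unfolding b'(9) using t(1) by (simp add: arr_iff)
      finally show ?thesis using u(1) by blast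
    qed
    show "u = u'" if u: "arr C P T u" "arr C P T u'" "u \<cdot> g = u' \<cdot> g" for u u'
    proof (rule P(7)[OF u(1,2)])
      have e: "u \<cdot> (g \<cdot> x) = u' \<cdot> (g \<cdot> x)" if "arr C X S x" for X x
        using Comp_assoc[OF that g u(1)] Comp_assoc[OF that g u(2)] u(3) by simp
      show "u \<cdot> c = u' \<cdot> c" using e[OF b'(1)] gb1 by simp
      have eq: "neg (u \<cdot> h) = neg (u' \<cdot> h)" using e[OF b'(2)] gb2 u(1,2) P(3) by (simp add: arr_iff)
      have "u \<cdot> h = neg (neg (u \<cdot> h))" "neg (neg (u' \<cdot> h)) = u' \<cdot> h"
        using u(1,2) P(3) by (simp_all add: arr_iff)
      then show "u \<cdot> h = u' \<cdot> h" unfolding eq by simp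
    qed
  qed
  then show ?thesis using ses_of_cokernel[OF ki] unfolding k_def g_def by blast
qed

text \<open>
  If \<open>x\<close> on \<open>Y\<close> and \<open>y\<close> on \<open>A\<close> agree on \<open>K\<close>, then \<open>x\<close> vanishes on the common kernel \<open>V\<close> and factors through
  \<open>d\<close>; the factor restricts to \<open>y\<close> because \<open>p\<close> is epi. Pullbacks of deflations are squares of this form.
\<close>

lemma deflation_square_pushout:
  assumes s: "ses C E V Y B v d" and s': "ses C E V K A v' p" and k: "arr C K Y k" "k \<cdot> v' = v"
    and f: "arr C A B f" and sq: "d \<cdot> k = f \<cdot> p"
  shows "is_pushout C K Y A B k p d f"
proof (rule is_pushoutI[OF k(1) sesD(2)[OF s'] sesD(2)[OF s] f sq])
  note S = sesD[OF s] and S' = sesD[OF s']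
  note D = is_cokernelD[OF S(4)] and D' = is_cokernelD[OF S'(4)]
  fix T
  show "u = u'" if "arr C B T u" "arr C B T u'" "u \<cdot> d = u' \<cdot> d" for u u'
    using that by (rule D(5))
  show "\<exists>u. arr C B T u \<and> u \<cdot> d = x \<and> u \<cdot> f = y"
    if x: "arr C Y T x" and y: "arr C A T y" and xy: "x \<cdot> k = y \<cdot> p" for x y
  proof -
    have T: "T \<in> Ob C" using x arr_Ob by blast
    have "x \<cdot> v = x \<cdot> k \<cdot> v'" using x k S'(1) by (simp add: arr_iff)
    also have "\<dots> = Zero C V T" unfolding xy using y D'(3) S' T by (simp add: arr_iff)
    finally obtain u where u: "arr C B T u" "u \<cdot> d = x" using D(4)[OF x] by blast
    have "u \<cdot> f \<cdot> p = u \<cdot> d \<cdot> k" using u(1) f k(1) S(2) S'(2) sq by (simp add: arr_iff)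
    then have "u \<cdot> f = y"
      using D'(5)[of T "u \<cdot> f" y] u f y xy by (simp add: arr_iff)
    then show ?thesis using u by blast
  qed
qed

end

section \<open>Cotorsion pairs\<close>

context exact_category
begin

text \<open>
  Any two split extensions are equivalent, and there is at least one, so a single class remains.
  With \<open>ses_splits\<close> below this restates the vanishing of \<open>Ext\<^sup>1\<close> in a form that dualises at once.
\<close>

lemma Ext1_eq_zeroI:
  assumes O: "A \<in> Ob C" "B \<in> Ob C"
    and split: "\<And>Y i d. ses C E B Y A i d \<Longrightarrow> \<exists>s r. is_biproduct C B A Y i s r d"
  shows "Ext1 C E A B = {Ext1_zero C E A B}"
proof -
  let ?X = "extensions C E A B"
  obtain S i s r d where "is_biproduct C B A S i s r d"
    using direct_sum_exists O unfolding is_direct_sum_def by blast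
  then have ne: "(S, i, d) \<in> ?X"
    using ses_split unfolding extensions_def by blast
  have zero: "Ext1_zero C E A B = ?X"
    using split unfolding Ext1_zero_def extensions_def by auto
  have "\<exists>\<phi>. is_iso C Y Y' \<phi> \<and> \<phi> \<cdot> i = i' \<and> d' \<cdot> \<phi> = d"
    if e: "ses C E B Y A i d" "ses C E B Y' A i' d'" for Y Y' i i' d d'
  proof -
    obtain s r where b: "is_biproduct C B A Y i s r d" using split[OF e(1)] by blast
    obtain s' r' where b': "is_biproduct C B A Y' i' s' r' d'" using split[OF e(2)] by blast
    note D = biproductD(1-4)[OF b] and D' = biproductD(1-4)[OF b']
    have Y: "Y \<in> Ob C" "Y' \<in> Ob C" using arr_Ob[OF D(1)] arr_Ob[OF D'(1)] by auto
    define \<phi> where "\<phi> = i' \<cdot> r \<uplus> s' \<cdot> d"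
    define \<psi> where "\<psi> = i \<cdot> r' \<uplus> s \<cdot> d'"
    have \<phi>: "arr C Y Y' \<phi>" and \<psi>: "arr C Y' Y \<psi>"
      unfolding \<phi>_def \<psi>_def using D D' by (simp_all add: arr_iff)
    have "\<psi> \<cdot> \<phi> = i \<cdot> r \<uplus> s \<cdot> d"
      unfolding \<phi>_def \<psi>_def using D D' O Y
        biproduct_Comp(1,2)[OF b' D(3)] biproduct_Comp(3,4)[OF b' D(4)] by (simp add: arr_iff)
    moreover have "\<phi> \<cdot> \<psi> = i' \<cdot> r' \<uplus> s' \<cdot> d'"
      unfolding \<phi>_def \<psi>_def using D D' O Y
        biproduct_Comp(1,2)[OF b D'(3)] biproduct_Comp(3,4)[OF b D'(4)] by (simp add: arr_iff)
    ultimately have "is_iso C Y Y' \<phi>"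
      using is_isoI(1)[OF \<phi> \<psi>] biproductD(9)[OF b] biproductD(9)[OF b'] by simp
    moreover have "\<phi> \<cdot> i = i'"
      unfolding \<phi>_def using D D' O biproductD(5,7)[OF b] by (simp add: arr_iff)
    moreover have "d' \<cdot> \<phi> = d"
      unfolding \<phi>_def using D D' O Y biproduct_Comp(1,2)[OF b' D(3)] biproduct_Comp(3,4)[OF b' D(4)] by (simp add: arr_iff)
    ultimately show ?thesis by blast
  qed
  then have "extension_equiv C E A B = ?X \<times> ?X"
    unfolding extension_equiv_def extensions_def by auto
  then show ?thesis
    unfolding Ext1_def zero quotient_def using ne by auto
qed

end

context cotorsion_pair
begin

lemma U_Ob: "A \<in> U \<Longrightarrow> A \<in> Ob C" and V_Ob: "A \<in> V \<Longrightarrow> A \<in> Ob C"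
  using U_additive V_additive unfolding is_additive_subcategory_def by auto

lemma ses_splits:
  assumes "ses C E B Y A i d" "A \<in> U" "B \<in> V"
  shows "\<exists>s r. is_biproduct C B A Y i s r d"
proof -
  have x: "(Y, i, d) \<in> extensions C E A B" using assms(1) unfolding extensions_def by simp
  note S = sesD[OF assms(1)]
  have "((Y, i, d), (Y, i, d)) \<in> extension_equiv C E A B"
    unfolding extension_equiv_def using x is_iso_Idt[OF S(8)] S by (auto simp: arr_iff)
  moreover have "extension_equiv C E A B `` {(Y, i, d)} = Ext1_zero C E A B"
    using quotientI[OF x, of "extension_equiv C E A B"] Ext1_vanishes[OF assms(2,3)] unfolding Ext1_def by simp
  ultimately show ?thesis unfolding Ext1_zero_def by blast
qed

lemma cotorsion_pair_op: "cotorsion_pair (op_cat C) (E\<inverse>) V U"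
proof -
  interpret op: exact_category "op_cat C" "E\<inverse>" by (rule exact_category_op)
  show ?thesis
  proof
    show "Ext1 (op_cat C) (E\<inverse>) A B = {Ext1_zero (op_cat C) (E\<inverse>) A B}" if AB: "A \<in> V" "B \<in> U" for A B
    proof (rule op.Ext1_eq_zeroI)
      show "A \<in> Ob (op_cat C)" "B \<in> Ob (op_cat C)" using that U_Ob V_Ob by auto
      fix Y i d assume "ses (op_cat C) (E\<inverse>) B Y A i d"
      then have "ses C E A Y B d i" by simp
      then obtain s r where "is_biproduct C A B Y d s r i" using ses_splits AB by blast
      then show "\<exists>s r. is_biproduct (op_cat C) B A Y i s r d" unfolding is_biproduct_op using biproduct_sym by blast
    qed
    show "\<exists>V\<^sub>B U\<^sub>B i d. V\<^sub>B \<in> U \<and> U\<^sub>B \<in> V \<and> ses (op_cat C) (E\<inverse>) V\<^sub>B U\<^sub>B B i d"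
      if "B \<in> Ob (op_cat C)" for B
      using right_approximation[of B] that by auto
    show "\<exists>V' U' i d. V' \<in> U \<and> U' \<in> V \<and> ses (op_cat C) (E\<inverse>) B V' U' i d"
      if "B \<in> Ob (op_cat C)" for B
      using left_approximation[of B] that by auto
  qed (simp_all add: U_additive V_additive U_summands V_summands)
qed

text \<open>
  Push the sequence out along \<open>h\<close>: the result is an extension of \<open>A\<close> by \<open>M\<close>, hence splits.
\<close>

lemma extend_to_V:
  assumes s: "ses C E X Y A i d" "A \<in> U" and h: "arr C X M h" "M \<in> V"
  shows "\<exists>h'. arr C Y M h' \<and> h' \<cdot> i = h"
proof -
  note S = sesD[OF s(1)]
  obtain P i' g where po: "is_pushout C X Y M P i h g i'"
    using inflation_pushout[OF S(1,5) h(1)] by blast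
  note P = is_pushoutD[OF po]
  obtain d' where "ses C E M P A i' d'" using pushout_ses[OF po s(1)] by blast
  then obtain t r where b: "is_biproduct C M A P i' t r d'" using ses_splits s(2) h(2) by blast
  have "(r \<cdot> g) \<cdot> i = (r \<cdot> i') \<cdot> h" using biproductD(3)[OF b] P(1-5) by (simp add: arr_iff)
  also have "\<dots> = h" unfolding biproductD(5)[OF b] using h by (simp add: arr_iff)
  finally show ?thesis
    using biproductD(3)[OF b] P(3) by (intro exI[of _ "r \<cdot> g"]) (simp add: arr_iff)
qed

lemma lift_from_U:
  assumes "ses C E B Y X i d" "B \<in> V" "arr C A X h" "A \<in> U"
  shows "\<exists>h'. arr C A Y h' \<and> d \<cdot> h' = h"
  using cotorsion_pair.extend_to_V[OF cotorsion_pair_op, of X Y B d i A h] assms by simp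

text \<open>
  The inflation of an approximation \<open>VB \<rightarrow> UB \<rightarrow> B\<close> factors as \<open>VB \<rightarrow> K \<rightarrow> UB\<close> with cokernels \<open>A\<close> and \<open>Z\<close>
  in \<open>U\<close>. Extending the identity of \<open>VB\<close> over both steps gives a retraction, so \<open>B\<close> is a summand
  of \<open>UB\<close>.
\<close>

lemma U_extension:
  assumes s: "ses C E A B Z i d" and A: "A \<in> U" and Z: "Z \<in> U"
  shows "B \<in> U"
proof -
  obtain VB UB v u where V: "VB \<in> V" "UB \<in> U" "ses C E VB UB B v u"
    using left_approximation sesD(8)[OF s] by blast
  obtain K k p v' where K: "ses C E K UB Z k (d \<cdot> u)" "ses C E VB K A v' p" "k \<cdot> v' = v"
    using ses_Comp_deflation[OF V(3) s] by blast
  have "arr C VB VB (Idt C VB)" using V_Ob[OF V(1)] by (simp add: arr_iff)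
  then obtain r where r: "arr C K VB r" "r \<cdot> v' = Idt C VB"
    using extend_to_V[OF K(2) A _ V(1)] by blast
  then obtain r' where r': "arr C UB VB r'" "r' \<cdot> k = r"
    using extend_to_V[OF K(1) Z _ V(1)] by blast
  have "r' \<cdot> (k \<cdot> v') = (r' \<cdot> k) \<cdot> v'"
    using r'(1) sesD(1)[OF K(1)] sesD(1)[OF K(2)] by (simp add: arr_iff)
  then have "r' \<cdot> v = Idt C VB" using K(3) r r' by simp
  then obtain t where "is_biproduct C VB B UB v t r' u" using split_of_retraction[OF V(3) r'(1)] by blast
  then show ?thesis using U_summands V(2) unfolding closed_under_summands_def is_direct_sum_def by blast
qed

lemma V_extension:
  assumes "ses C E A B Z i d" "A \<in> V" "Z \<in> V"
  shows "B \<in> V"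
  using cotorsion_pair.U_extension[OF cotorsion_pair_op, of Z B A d i] assms by simp

lemma zero_object_in:
  assumes "is_zero_object C z"
  shows "z \<in> U" "z \<in> V"
proof -
  obtain A B where "A \<in> U" "B \<in> V"
    using U_additive V_additive unfolding is_additive_subcategory_def by blast
  moreover have "is_direct_sum C A z A" "is_direct_sum C B z B"
    using biproduct_zero assms calculation U_Ob V_Ob unfolding is_direct_sum_def by blast+
  ultimately show "z \<in> U" "z \<in> V"
    using U_summands V_summands unfolding closed_under_summands_def by blast+
qed

lemma core_biproduct:
  assumes "is_biproduct C A B S i1 i2 p1 p2" "A \<in> U \<inter> V" "B \<in> U \<inter> V"
  shows "S \<in> U \<inter> V"
  using U_extension V_extension ses_split[OF assms(1)] assms(2,3) by blast

lemma core_additive: "is_additive_subcategory C (U \<inter> V)"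
proof -
  obtain z where z: "is_zero_object C z" using zero_object_exists by blast
  have "\<exists>S\<in>U \<inter> V. is_direct_sum C A B S" if "A \<in> U \<inter> V" "B \<in> U \<inter> V" for A B
    using direct_sum_exists[of A B] that U_Ob core_biproduct unfolding is_direct_sum_def by (meson IntD1)
  then show ?thesis
    unfolding is_additive_subcategory_def using zero_object_in z U_Ob by blast
qed

lemma core_subset_B_plus: "U \<inter> V \<subseteq> B_plus C E U V"
proof
  fix M assume M: "M \<in> U \<inter> V"
  obtain z where z: "is_zero_object C z" using zero_object_exists by blast
  have "ses C E z M M (Zero C z M) (Idt C M)" using ses_Zero_Idt z M U_Ob by blast
  then show "M \<in> B_plus C E U V" unfolding B_plus_def using zero_object_in(2)[OF z] M U_Ob by blast
qed

lemma core_subset_B_minus: "U \<inter> V \<subseteq> B_minus C E U V"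
  using cotorsion_pair.core_subset_B_plus[OF cotorsion_pair_op] by auto

lemma B_plus_biproduct:
  assumes b: "is_biproduct C A B S i1 i2 p1 p2" and A: "A \<in> B_plus C E U V" and B: "B \<in> B_plus C E U V"
  shows "S \<in> B_plus C E U V"
proof -
  obtain V1 W1 v1 w1 where 1: "V1 \<in> V" "W1 \<in> U \<inter> V" "ses C E V1 W1 A v1 w1"
    using A unfolding B_plus_def by blast
  obtain V2 W2 v2 w2 where 2: "V2 \<in> V" "W2 \<in> U \<inter> V" "ses C E V2 W2 B v2 w2"
    using B unfolding B_plus_def by blast
  obtain V3 a1 a2 a3 a4 where 3: "V3 \<in> V" "is_biproduct C V1 V2 V3 a1 a2 a3 a4"
    using V_additive 1(1) 2(1) unfolding is_additive_subcategory_def is_direct_sum_def by blast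
  obtain W3 b1 b2 b3 b4 where 4: "W3 \<in> U \<inter> V" "is_biproduct C W1 W2 W3 b1 b2 b3 b4"
    using core_additive 1(2) 2(2) unfolding is_additive_subcategory_def is_direct_sum_def by blast
  have "S \<in> Ob C" using biproductD(1)[OF b] arr_Ob by blast
  then show ?thesis
    unfolding B_plus_def using 3(1) 4(1) ses_sum[OF 1(3) 2(3) 3(2) 4(2) b] by blast
qed

lemma B_minus_biproduct:
  assumes "is_biproduct C A B S i1 i2 p1 p2" "A \<in> B_minus C E U V" "B \<in> B_minus C E U V"
  shows "S \<in> B_minus C E U V"
  using cotorsion_pair.B_plus_biproduct[OF cotorsion_pair_op, of A B S p1 p2 i1 i2] assms by simp

text \<open>
  Push out \<open>B \<rightarrow> W'\<close> and \<open>B \<rightarrow> P\<close> to an object \<open>D\<close>. It is an extension of \<open>A\<close> by \<open>W'\<close>, so it is in \<open>U\<close> and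
  embeds into an object of the core with cokernel in \<open>U\<close>; the composite of \<open>P \<rightarrow> D\<close> with this embedding
  is the required inflation.
\<close>

lemma B_minus_extension:
  assumes B: "B \<in> B_minus C E U V" and A: "A \<in> U" and s: "ses C E B P A c e"
  shows "P \<in> B_minus C E U V"
proof -
  obtain W' U' j k where 1: "W' \<in> U \<inter> V" "U' \<in> U" "ses C E B W' U' j k"
    using B unfolding B_minus_def by blast
  note S = sesD[OF 1(3)]
  obtain D g j' where po: "is_pushout C B W' P D j c g j'"
    using inflation_pushout[OF S(1,5) sesD(1)[OF s]] by blast
  obtain d1 where d1: "ses C E P D U' j' d1" using pushout_ses[OF po 1(3)] by blast
  obtain d2 where "ses C E W' D A g d2" using pushout_ses[OF is_pushout_sym[OF po] s] by blast
  then have D: "D \<in> U" using U_extension 1(1) A by blast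
  obtain V' U'' m n where 2: "V' \<in> V" "U'' \<in> U" "ses C E D V' U'' m n"
    using right_approximation U_Ob[OF D] by blast
  have V': "V' \<in> U" using U_extension[OF 2(3) D 2(2)] .
  obtain Q p q e' where 3: "ses C E P V' Q (m \<cdot> j') p" "ses C E U' Q U'' q e'"
    using ses_Comp_inflation[OF d1 2(3)] by blast
  have "Q \<in> U" using U_extension[OF 3(2) 1(2) 2(2)] .
  then show ?thesis unfolding B_minus_def using sesD(7)[OF d1] V' 2(1) 3(1) by blast
qed

lemma B_plus_coextension:
  assumes "A \<in> B_plus C E U V" "B \<in> V" "ses C E B K A v p"
  shows "K \<in> B_plus C E U V"
  using cotorsion_pair.B_minus_extension[OF cotorsion_pair_op, of A B K p v] assms by simp

section \<open>Cokernels modulo the core of a cotorsion pair\<close>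

text \<open>
  The core of the cotorsion pair is \<open>U \<inter> V\<close>. The predicate \<open>null X Y f\<close> says that \<open>f\<close> becomes zero in the
  quotient by the core.
\<close>

abbreviation null :: "'o \<Rightarrow> 'o \<Rightarrow> 'm \<Rightarrow> bool" where
  "null X Y f \<equiv> f \<in> factoring_through C (U \<inter> V) X Y"

lemma nullI: "\<lbrakk>M \<in> U; M \<in> V; arr C X M a; arr C M Y b\<rbrakk> \<Longrightarrow> null X Y (b \<cdot> a)"
  unfolding factoring_through_def by blast

lemma nullE:
  assumes "null X Y f"
  obtains M a b where "M \<in> U" "M \<in> V" "arr C X M a" "arr C M Y b" "f = b \<cdot> a"
  using assms unfolding factoring_through_def by blast

text \<open>
  The middle object of a factorization of \<open>t\<close> lies in \<open>U\<close>, so the second factor lifts along \<open>w\<close>.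
\<close>

lemma null_lift:
  assumes s: "ses C E V' W' Z v w" "V' \<in> V" and t: "null X Z t"
  shows "\<exists>l. arr C X W' l \<and> w \<cdot> l = t"
proof -
  obtain M a b where M: "M \<in> U" "arr C X M a" "arr C M Z b" "t = b \<cdot> a"
    using t by (rule nullE)
  obtain b' where b': "arr C M W' b'" "w \<cdot> b' = b" using lift_from_U[OF s M(3,1)] by blast
  have "w \<cdot> (b' \<cdot> a) = t"
    using M b' sesD(2)[OF s(1)] Comp_assoc[OF M(2) b'(1) sesD(2)[OF s(1)]] by simp
  then show ?thesis using b'(1) M(2) arr_Comp by blast
qed

text \<open>
  Let \<open>w : W' \<rightarrow> Z\<close> come from \<open>Z \<in> B\<^sup>+\<close>. The restriction \<open>t i\<close> factors through \<open>w\<close>, and the factor extends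
  to \<open>Y\<close>. What remains of \<open>t\<close> vanishes on \<open>X\<close>, hence is induced from \<open>A \<in> U\<close> and factors through \<open>w\<close> as
  well. This gives the uniqueness half of every universal property in the heart.
\<close>

lemma null_extension:
  assumes s: "ses C E X Y A i d" "A \<in> U" and Z: "Z \<in> B_plus C E U V"
    and t: "arr C Y Z t" and n: "null X Z (t \<cdot> i)"
  shows "null Y Z t"
proof -
  note S = sesD[OF s(1)]
  have ZO: "Z \<in> Ob C" using arr_Ob[OF t] by simp
  obtain V' W' v w where 1: "V' \<in> V" "W' \<in> U \<inter> V" "ses C E V' W' Z v w"
    using Z unfolding B_plus_def by blast
  note w = sesD(2)[OF 1(3)]
  obtain l where l: "arr C X W' l" "w \<cdot> l = t \<cdot> i" using null_lift[OF 1(3,1) n] by blast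
  obtain l' where l': "arr C Y W' l'" "l' \<cdot> i = l" using extend_to_V[OF s l(1)] 1(2) by blast
  obtain r where r: "arr C Y Z r" "t = w \<cdot> l' \<uplus> r"
    using difference_exists[OF t arr_Comp[OF l'(1) w]] by blast
  have "t \<cdot> i = (w \<cdot> l') \<cdot> i \<uplus> r \<cdot> i"
    unfolding r(2) using w l'(1) r(1) S(1) by (simp add: arr_iff)
  moreover have "(w \<cdot> l') \<cdot> i = t \<cdot> i" using w l' l S(1) by (simp add: arr_iff)
  ultimately have "r \<cdot> i = Zero C X Z"
    using difference_Zero[OF arr_Comp[OF S(1) t] arr_Comp[OF S(1) r(1)]] by simp
  then obtain x where x: "arr C A Z x" "x \<cdot> d = r" using is_cokernelD(4)[OF S(4) r(1)] by blast
  obtain x' where x': "arr C A W' x'" "w \<cdot> x' = x" using lift_from_U[OF 1(3,1) x(1) s(2)] by blast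
  have "w \<cdot> (x' \<cdot> d) = r" using Comp_assoc[OF S(2) x'(1) w] x x' by simp
  then have "t = w \<cdot> (l' \<uplus> x' \<cdot> d)" unfolding r(2) using w l'(1) x'(1) S(2) by (simp add: arr_iff)
  moreover have "arr C Y W' (l' \<uplus> x' \<cdot> d)" using l'(1) x'(1) S(2) by (simp add: arr_iff)
  ultimately show ?thesis using nullI 1(2) w by blast
qed

text \<open>
  Enlarge the middle term of an approximation \<open>VX \<rightarrow> UX \<rightarrow> X\<close> to an object \<open>W'\<close> of the core and take the
  quotient \<open>P = W'/VX\<close>. An arrow from \<open>X\<close> to \<open>Y \<in> B\<^sup>+\<close> lifts on \<open>UX\<close> to the core object over \<open>Y\<close>, the lift
  extends to \<open>W'\<close>, and passing to quotients yields \<open>P \<rightarrow> Y\<close>.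

  The last clause is what makes the reflection useful for epimorphisms: if \<open>q\<close> is null it lifts along
  \<open>W' \<rightarrow> P\<close>, the lift lands in \<open>UX\<close>, and this splits \<open>UX \<rightarrow> X\<close>.
\<close>

lemma B_plus_reflection:
  assumes X: "X \<in> Ob C"
  shows "\<exists>P q e A. A \<in> U \<and> P \<in> B_plus C E U V \<and> ses C E X P A q e \<and>
    (\<forall>Y t. Y \<in> B_plus C E U V \<and> arr C X Y t \<longrightarrow> (\<exists>s. arr C P Y s \<and> s \<cdot> q = t)) \<and>
    (null X P q \<longrightarrow> X \<in> U)"
proof -
  obtain VX UX v u where 1: "VX \<in> V" "UX \<in> U" "ses C E VX UX X v u"
    using left_approximation X by blast
  note S1 = sesD[OF 1(3)]
  obtain W' U' j e where 2: "W' \<in> V" "U' \<in> U" "ses C E UX W' U' j e"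
    using right_approximation S1(8) by blast
  note S2 = sesD[OF 2(3)]
  have W': "W' \<in> U" using U_extension[OF 2(3) 1(2) 2(2)] .
  obtain P p q e' where 3: "ses C E VX W' P (j \<cdot> v) p" "ses C E X P U' q e'" "e' \<cdot> p = e" "p \<cdot> j = q \<cdot> u"
    using ses_Comp_inflation[OF 1(3) 2(3)] by blast
  note S3 = sesD[OF 3(1)] and S4 = sesD[OF 3(2)]
  have P: "P \<in> B_plus C E U V" unfolding B_plus_def using 1(1) 2(1) W' 3(1) S3(9) by blast
  have 4: "\<exists>s. arr C P Y s \<and> s \<cdot> q = t" if Y: "Y \<in> B_plus C E U V" and t: "arr C X Y t" for Y t
  proof -
    have YO: "Y \<in> Ob C" using arr_Ob[OF t] by simp
    obtain VY WY y w where 5: "VY \<in> V" "WY \<in> U \<inter> V" "ses C E VY WY Y y w"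
      using Y unfolding B_plus_def by blast
    note w = sesD(2)[OF 5(3)]
    obtain a where a: "arr C UX WY a" "w \<cdot> a = t \<cdot> u"
      using lift_from_U[OF 5(3,1) arr_Comp[OF S1(2) t] 1(2)] by blast
    obtain b where b: "arr C W' WY b" "b \<cdot> j = a" using extend_to_V[OF 2(3,2) a(1)] 5(2) by blast
    have "(w \<cdot> b) \<cdot> (j \<cdot> v) = w \<cdot> ((b \<cdot> j) \<cdot> v)" using w b(1) S2(1) S1(1) by (simp add: arr_iff)
    also have "\<dots> = (w \<cdot> a) \<cdot> v" unfolding b(2) using w a(1) S1(1) by (simp add: arr_iff)
    also have "\<dots> = t \<cdot> (u \<cdot> v)" unfolding a(2) using t S1(1,2) by (simp add: arr_iff)
    also have "\<dots> = Zero C VX Y" using is_cokernelD(3)[OF S1(4)] t S1(7) by (simp add: arr_iff)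
    finally obtain s where s: "arr C P Y s" "s \<cdot> p = w \<cdot> b"
      using is_cokernelD(4)[OF S3(4) arr_Comp[OF b(1) w]] by blast
    have "(s \<cdot> q) \<cdot> u = (s \<cdot> p) \<cdot> j" using s(1) 3(4) S1(2) S4(1) S2(1) S3(2) by (simp add: arr_iff)
    also have "\<dots> = t \<cdot> u" unfolding s(2) using w b S2(1) a by (simp add: arr_iff)
    finally have "s \<cdot> q = t"
      using is_cokernelD(5)[OF S1(4) arr_Comp[OF S4(1) s(1)] t] by blast
    then show ?thesis using s by blast
  qed
  have 5: "X \<in> U" if n: "null X P q"
  proof -
    obtain l where l: "arr C X W' l" "p \<cdot> l = q" using null_lift[OF 3(1) 1(1) n] by blast
    have "e \<cdot> l = e' \<cdot> (p \<cdot> l)" using l(1) S3(2) S4(2) unfolding 3(3)[symmetric] by (simp add: arr_iff)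
    also have "\<dots> = Zero C X U'" unfolding l(2) using is_kernelD(3)[OF S4(3)] .
    finally obtain s where s: "arr C X UX s" "j \<cdot> s = l" using is_kernelD(4)[OF S2(3) l(1)] by blast
    have "q \<cdot> (u \<cdot> s) = (q \<cdot> u) \<cdot> s" using S1(2) S4(1) s(1) by (simp add: arr_iff)
    also have "\<dots> = p \<cdot> (j \<cdot> s)" unfolding 3(4)[symmetric] using S2(1) S3(2) s(1) by (simp add: arr_iff)
    also have "\<dots> = q \<cdot> Idt C X" unfolding s(2) l(2) using S4(1) X by (simp add: arr_iff)
    finally have "u \<cdot> s = Idt C X"
      using is_kernelD(5)[OF S4(3) arr_Comp[OF s(1) S1(2)] arr_Idt[OF X]] by blast
    then obtain r where "is_biproduct C VX X UX v s r u"
      using split_of_section[OF 1(3) s(1)] by blast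
    then show ?thesis
      using U_summands 1(2) unfolding closed_under_summands_def is_direct_sum_def by blast
  qed
  show ?thesis using 2(2) P 3(2) 4 5 by blast
qed

text \<open>
  The arrow \<open>t f\<close> factors through an object of \<open>V\<close>, so it extends along \<open>j\<close>, and the extension glues
  with \<open>t\<close>.
\<close>

lemma pushout_extend:
  assumes s: "ses C E A W' U' j e" "U' \<in> U" and po: "is_pushout C A W' B P j f h c"
    and t: "arr C B Y t" and n: "null A Y (t \<cdot> f)"
  shows "\<exists>u. arr C P Y u \<and> u \<cdot> c = t"
proof -
  obtain M a b where M: "M \<in> V" "arr C A M a" "arr C M Y b" "t \<cdot> f = b \<cdot> a"
    using n by (rule nullE)
  obtain a' where a': "arr C W' M a'" "a' \<cdot> j = a" using extend_to_V[OF s M(2,1)] by blast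
  have "(b \<cdot> a') \<cdot> j = t \<cdot> f" using M a' sesD(1)[OF s(1)] by (simp add: arr_iff)
  then show ?thesis using is_pushoutD(6)[OF po arr_Comp[OF a'(1) M(3)] t] by blast
qed

text \<open>
  The composite \<open>B \<rightarrow> P \<rightarrow> Q\<close> of a pushout and a reflection. Existence of factorizations holds on the
  nose by \<open>pushout_extend\<close> and the reflection property; uniqueness modulo null arrows is
  \<open>null_extension\<close> applied to \<open>P \<rightarrow> Q\<close> and to \<open>B \<rightarrow> P\<close>.
\<close>

lemma null_cokernel_exists:
  assumes A: "A \<in> B_minus C E U V" and B: "B \<in> B_minus C E U V" and f: "arr C A B f"
  shows "\<exists>Q q. Q \<in> B_plus C E U V \<inter> B_minus C E U V \<and> arr C B Q q \<and> null A Q (q \<cdot> f) \<and>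
    (\<forall>Y t. Y \<in> B_plus C E U V \<and> arr C B Y t \<and> null A Y (t \<cdot> f) \<longrightarrow> (\<exists>u. arr C Q Y u \<and> u \<cdot> q = t)) \<and>
    (\<forall>Y u. Y \<in> B_plus C E U V \<and> arr C Q Y u \<and> null B Y (u \<cdot> q) \<longrightarrow> null Q Y u)"
proof -
  obtain W' U' j e where 1: "W' \<in> U \<inter> V" "U' \<in> U" "ses C E A W' U' j e"
    using A unfolding B_minus_def by blast
  note S = sesD[OF 1(3)]
  obtain P h c where po: "is_pushout C A W' B P j f h c"
    using inflation_pushout[OF S(1,5) f] by blast
  note P = is_pushoutD[OF po]
  obtain k where k: "ses C E B P U' c k" using pushout_ses[OF po 1(3)] by blast
  have PO: "P \<in> Ob C" using P(3) arr_Ob by blast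
  have Pm: "P \<in> B_minus C E U V" using B_minus_extension[OF B 1(2) k] .
  obtain Q r l D where Q: "D \<in> U" "Q \<in> B_plus C E U V" "ses C E P Q D r l"
    "\<And>Y t. Y \<in> B_plus C E U V \<Longrightarrow> arr C P Y t \<Longrightarrow> \<exists>s. arr C Q Y s \<and> s \<cdot> r = t"
    using B_plus_reflection[OF PO] by blast
  note r = sesD(1)[OF Q(3)]
  have Qm: "Q \<in> B_minus C E U V" using B_minus_extension[OF Pm Q(1,3)] .
  have "(r \<cdot> c) \<cdot> f = (r \<cdot> h) \<cdot> j" using r P(1-5) by (simp add: arr_iff)
  then have 2: "null A Q ((r \<cdot> c) \<cdot> f)" using nullI 1(1) S(1) arr_Comp[OF P(3) r] by auto
  have 3: "\<exists>u. arr C Q Y u \<and> u \<cdot> (r \<cdot> c) = t"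
    if Y: "Y \<in> B_plus C E U V" "arr C B Y t" "null A Y (t \<cdot> f)" for Y t
  proof -
    obtain x where x: "arr C P Y x" "x \<cdot> c = t" using pushout_extend[OF 1(3,2) po Y(2,3)] by blast
    obtain u where u: "arr C Q Y u" "u \<cdot> r = x" using Q(4)[OF Y(1) x(1)] by blast
    have "u \<cdot> (r \<cdot> c) = t" using Comp_assoc[OF P(4) r u(1)] u x by simp
    then show ?thesis using u by blast
  qed
  have 4: "null Q Y u" if Y: "Y \<in> B_plus C E U V" "arr C Q Y u" "null B Y (u \<cdot> (r \<cdot> c))" for Y u
  proof -
    have "null P Y (u \<cdot> r)"
      using null_extension[OF k 1(2) Y(1) arr_Comp[OF r Y(2)]] Comp_assoc[OF P(4) r Y(2)] Y(3) by simp
    then show ?thesis using null_extension[OF Q(3,1) Y(1,2)] by blast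
  qed
  show ?thesis using Q(2) Qm arr_Comp[OF P(4) r] 2 3 4 by blast
qed

text \<open>
  The object \<open>K\<close> is the pullback of a deflation \<open>w : W1 \<rightarrow> B \<oplus> W'\<close> along the inflation
  \<open>f' : A \<rightarrow> B \<oplus> W'\<close>. Since the cokernel \<open>P\<close> of \<open>f'\<close> lies in \<open>U\<close>, the arrow \<open>K \<rightarrow> W1\<close> plays for
  \<open>p : K \<rightarrow> A\<close> the role that \<open>A \<rightarrow> W'\<close> plays for \<open>f\<close> in the construction of cokernels, and the pullback
  square is the corresponding pushout; so \<open>pushout_extend\<close> applies to it.
\<close>

lemma null_epi_is_cokernel:
  assumes A: "A \<in> B_plus C E U V \<inter> B_minus C E U V" and B: "B \<in> B_plus C E U V \<inter> B_minus C E U V"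
    and f: "arr C A B f"
    and epi: "\<And>Y t. \<lbrakk>Y \<in> B_plus C E U V \<inter> B_minus C E U V; arr C B Y t; null A Y (t \<cdot> f)\<rbrakk> \<Longrightarrow> null B Y t"
  shows "\<exists>K k. K \<in> B_plus C E U V \<inter> B_minus C E U V \<and> arr C K A k \<and> null K B (f \<cdot> k) \<and>
    (\<forall>Y g. arr C A Y g \<and> null K Y (g \<cdot> k) \<longrightarrow> (\<exists>u n. arr C B Y u \<and> null A Y n \<and> g = u \<cdot> f \<uplus> n))"
proof -
  obtain W' U' j e where 1: "W' \<in> U \<inter> V" "U' \<in> U" "ses C E A W' U' j e"
    using A unfolding B_minus_def by blast
  note S = sesD[OF 1(3)]
  obtain P h c where po: "is_pushout C A W' B P j f h c"
    using inflation_pushout[OF S(1,5) f] by blast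
  note P = is_pushoutD[OF po]
  obtain k where k: "ses C E B P U' c k" using pushout_ses[OF po 1(3)] by blast
  have PO: "P \<in> Ob C" using P(3) arr_Ob by blast
  have Pm: "P \<in> B_minus C E U V" using B_minus_extension[OF _ 1(2) k] B by blast
  \<comment> \<open>Cancelling \<open>f\<close> makes \<open>B \<rightarrow> P \<rightarrow> Q\<close> null, then \<open>P \<rightarrow> Q\<close>, and the reflection detects \<open>P \<in> U\<close>.\<close>
  have PU: "P \<in> U"
  proof -
    obtain Q r l D where Q: "D \<in> U" "Q \<in> B_plus C E U V" "ses C E P Q D r l" "null P Q r \<Longrightarrow> P \<in> U"
      using B_plus_reflection[OF PO] by blast
    note r = sesD(1)[OF Q(3)]
    have Qm: "Q \<in> B_minus C E U V" using B_minus_extension[OF Pm Q(1,3)] .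
    have "(r \<cdot> c) \<cdot> f = (r \<cdot> h) \<cdot> j" using r P(1-5) by (simp add: arr_iff)
    then have "null A Q ((r \<cdot> c) \<cdot> f)" using nullI 1(1) S(1) arr_Comp[OF P(3) r] by auto
    then have "null B Q (r \<cdot> c)" using epi[of Q "r \<cdot> c"] Q(2) Qm arr_Comp[OF P(4) r] by blast
    then show ?thesis using Q(4) null_extension[OF k 1(2) Q(2) r] by blast
  qed
  obtain S0 b1 b2 q1 q2 where b: "is_biproduct C B W' S0 b1 b2 q1 q2"
    using direct_sum_exists[of B W'] arr_Ob[OF f] S(8) unfolding is_direct_sum_def by blast
  note b' = biproductD[OF b]
  define f' where "f' = b1 \<cdot> f \<uplus> b2 \<cdot> j"
  have f': "arr C A S0 f'" unfolding f'_def using b'(1,2) f S(1) by (simp add: arr_iff)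
  have s: "ses C E A S0 P f' (c \<cdot> q1 \<uplus> neg (h \<cdot> q2))"
    using pushout_ses_biproduct[OF 1(3) f po b] unfolding f'_def .
  have "S0 \<in> B_plus C E U V"
    using B_plus_biproduct[OF b] B 1(1) core_subset_B_plus by blast
  then obtain V1 W1 v w where 2: "V1 \<in> V" "W1 \<in> U \<inter> V" "ses C E V1 W1 S0 v w"
    unfolding B_plus_def by blast
  note w = sesD(2)[OF 2(3)]
  obtain K m p v' e' where 3: "ses C E K W1 P m e'" "ses C E V1 K A v' p" "m \<cdot> v' = v" "w \<cdot> m = f' \<cdot> p"
    using ses_Comp_deflation[OF 2(3) s] by blast
  note m = sesD(1)[OF 3(1)] and p = sesD(2)[OF 3(2)]
  have Km: "K \<in> B_minus C E U V" unfolding B_minus_def using 2(2) PU 3(1) sesD(7)[OF 3(1)] by blast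
  have Kp: "K \<in> B_plus C E U V" using B_plus_coextension[OF _ 2(1) 3(2)] A by blast
  have po': "is_pushout C K W1 A S0 m p w f'"
    by (rule deflation_square_pushout[OF 2(3) 3(2) m 3(3) f' 3(4)])
  have q1f': "q1 \<cdot> f' = f"
    using b'(1-4) f S arr_Ob[OF f] biproduct_Comp(1)[OF b f] biproduct_Comp(4)[OF b S(1)]
    unfolding f'_def by (simp add: arr_iff)
  have "f \<cdot> p = (q1 \<cdot> w) \<cdot> m"
    using Comp_assoc[OF p f' b'(3)] Comp_assoc[OF m w b'(3)] 3(4) unfolding q1f' by simp
  then have 4: "null K B (f \<cdot> p)" using nullI 2(2) m arr_Comp[OF w b'(3)] by auto
  have 5: "\<exists>u n. arr C B Y u \<and> null A Y n \<and> g = u \<cdot> f \<uplus> n"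
    if g: "arr C A Y g" "null K Y (g \<cdot> p)" for Y g
  proof -
    obtain u where u: "arr C S0 Y u" "u \<cdot> f' = g"
      using pushout_extend[OF 3(1) PU po' g] by blast
    \<comment> \<open>The component through \<open>W'\<close> is null, so the first component factors \<open>g\<close> modulo null arrows.\<close>
    have "g = (u \<cdot> b1) \<cdot> f \<uplus> (u \<cdot> b2) \<cdot> j"
      unfolding u(2)[symmetric] f'_def using u(1) b'(1,2) f S(1) by (simp add: arr_iff)
    moreover have "null A Y ((u \<cdot> b2) \<cdot> j)" using nullI 1(1) S(1) arr_Comp[OF b'(2) u(1)] by auto
    ultimately show ?thesis using arr_Comp[OF b'(1) u(1)] by blast
  qed
  show ?thesis using Km Kp p 4 5 by blast
qed

end

section \<open>The additive quotient\<close>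

locale additive_quotient_category = additive_category D
  for D :: "('o, 'm) cat" (structure) +
  fixes W :: "'o set"
  assumes W_additive: "is_additive_subcategory D W"
begin

abbreviation ideal :: "'o \<Rightarrow> 'o \<Rightarrow> 'm set" where
  "ideal \<equiv> factoring_through D W"

abbreviation cls :: "'o \<Rightarrow> 'o \<Rightarrow> 'm \<Rightarrow> 'm set" where
  "cls \<equiv> mor_class D W"

abbreviation quotient_cat :: "('o, 'm set) cat" where
  "quotient_cat \<equiv> additive_quotient D W"

lemma idealE:
  assumes "f \<in> ideal X Y"
  obtains M a b where "M \<in> W" "arr D X M a" "arr D M Y b" "f = b \<cdot> a"
  using assms unfolding factoring_through_def by blast

lemma idealI: "\<lbrakk>M \<in> W; arr D X M a; arr D M Y b\<rbrakk> \<Longrightarrow> b \<cdot> a \<in> ideal X Y"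
  unfolding factoring_through_def by blast

lemma ideal_arr: "f \<in> ideal X Y \<Longrightarrow> arr D X Y f"
  by (elim idealE) (simp add: arr_iff)

lemma ideal_Comp:
  assumes "f \<in> ideal X Y"
  shows "arr D Y Z g \<Longrightarrow> g \<cdot> f \<in> ideal X Z" "arr D T X h \<Longrightarrow> f \<cdot> h \<in> ideal T Y"
proof -
  obtain M a b where M: "M \<in> W" "arr D X M a" "arr D M Y b" "f = b \<cdot> a"
    using assms by (rule idealE)
  show "g \<cdot> f \<in> ideal X Z" if g: "arr D Y Z g"
    using idealI[OF M(1,2) arr_Comp[OF M(3) g]] Comp_assoc[OF M(2,3) g] M(4) by simp
  show "f \<cdot> h \<in> ideal T Y" if h: "arr D T X h"
    using idealI[OF M(1) arr_Comp[OF h M(2)] M(3)] Comp_assoc[OF h M(2,3)] M(4) by simp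
qed

lemma ideal_Zero:
  assumes "X \<in> Ob D" "Y \<in> Ob D"
  shows "Zero D X Y \<in> ideal X Y"
proof -
  obtain z where z: "z \<in> W" "z \<in> Ob D" using W_additive unfolding is_additive_subcategory_def by blast
  then have "Zero D z Y \<cdot> Zero D X z \<in> ideal X Y"
    using assms by (intro idealI) (simp_all add: arr_iff)
  then show ?thesis using assms z by simp
qed

text \<open>
  The sum of an arrow through \<open>M\<close> and an arrow through \<open>N\<close> factors through \<open>M \<oplus> N\<close>. This is where closure
  of \<open>W\<close> under direct sums enters.
\<close>

lemma ideal_Add:
  assumes "f \<in> ideal X Y" "g \<in> ideal X Y"
  shows "f \<uplus> g \<in> ideal X Y"
proof -
  obtain M a b where M: "M \<in> W" "arr D X M a" "arr D M Y b" "f = b \<cdot> a"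
    using assms(1) by (rule idealE)
  obtain N c d where N: "N \<in> W" "arr D X N c" "arr D N Y d" "g = d \<cdot> c"
    using assms(2) by (rule idealE)
  obtain S i1 i2 p1 p2 where S: "S \<in> W" "is_biproduct D M N S i1 i2 p1 p2"
    using W_additive M(1) N(1) unfolding is_additive_subcategory_def is_direct_sum_def by blast
  note B = biproductD(1-4)[OF S(2)]
  have O: "X \<in> Ob D" "Y \<in> Ob D" using arr_Ob[OF M(2)] arr_Ob[OF M(3)] by auto
  have "(b \<cdot> p1 \<uplus> d \<cdot> p2) \<cdot> (i1 \<cdot> a \<uplus> i2 \<cdot> c) = f \<uplus> g"
    using B M(2-4) N(2-4) O biproduct_Comp(1,2)[OF S(2) M(2)] biproduct_Comp(3,4)[OF S(2) N(2)]
    by (simp add: arr_iff)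
  moreover have "(b \<cdot> p1 \<uplus> d \<cdot> p2) \<cdot> (i1 \<cdot> a \<uplus> i2 \<cdot> c) \<in> ideal X Y"
    using B M(2-3) N(2-3) by (intro idealI[OF S(1)]) (simp_all add: arr_iff)
  ultimately show ?thesis by simp
qed

lemma ideal_neg:
  assumes "f \<in> ideal X Y"
  shows "neg f \<in> ideal X Y"
proof -
  have Y: "Y \<in> Ob D" and f: "arr D X Y f" using arr_Ob ideal_arr assms by blast+
  have "neg (Idt D Y) \<cdot> f = neg f" using Y f by (simp add: arr_iff)
  then show ?thesis
    using ideal_Comp(1)[OF assms, of Y "neg (Idt D Y)"] Y by (simp add: arr_iff)
qed

lemma cls_self: "arr D X Y f \<Longrightarrow> f \<in> cls X Y f"
  unfolding mor_class_def using ideal_Zero[of X Y] arr_Ob[of X Y f]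
  by (auto simp: arr_iff intro!: exI[of _ "Zero D X Y"])

lemma cls_arr: "\<lbrakk>arr D X Y f; g \<in> cls X Y f\<rbrakk> \<Longrightarrow> arr D X Y g"
  unfolding mor_class_def by (auto dest!: ideal_arr simp: arr_iff)

lemma cls_subset:
  assumes f: "arr D X Y f" and h: "h \<in> ideal X Y"
  shows "cls X Y (f \<uplus> h) \<subseteq> cls X Y f"
proof
  fix g assume "g \<in> cls X Y (f \<uplus> h)"
  then obtain k where k: "k \<in> ideal X Y" "g = f \<uplus> h \<uplus> k" unfolding mor_class_def by blast
  have "g = f \<uplus> (h \<uplus> k)"
    using k f ideal_arr[OF k(1)] ideal_arr[OF h] by (simp add: arr_iff Add_assoc)
  then show "g \<in> cls X Y f" unfolding mor_class_def using ideal_Add[OF h k(1)] by blast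
qed

lemma cls_eqI:
  assumes f: "arr D X Y f" and h: "h \<in> ideal X Y"
  shows "cls X Y (f \<uplus> h) = cls X Y f"
proof
  show "cls X Y (f \<uplus> h) \<subseteq> cls X Y f" by (rule cls_subset[OF f h])
  note h' = ideal_arr[OF h]
  have "cls X Y (f \<uplus> h \<uplus> neg h) \<subseteq> cls X Y (f \<uplus> h)"
    using f h' by (intro cls_subset ideal_neg[OF h]) (simp add: arr_iff)
  moreover have "f \<uplus> h \<uplus> neg h = f"
    using f h' by (simp add: arr_iff Add_assoc)
  ultimately show "cls X Y f \<subseteq> cls X Y (f \<uplus> h)" by simp
qed

lemma cls_eq_iff:
  assumes f: "arr D X Y f" and g: "arr D X Y g"
  shows "cls X Y f = cls X Y g \<longleftrightarrow> (\<exists>h\<in>ideal X Y. f = g \<uplus> h)"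
proof
  assume "cls X Y f = cls X Y g"
  then have "f \<in> cls X Y g" using cls_self[OF f] by simp
  then show "\<exists>h\<in>ideal X Y. f = g \<uplus> h" unfolding mor_class_def by blast
qed (use cls_eqI[OF g] in blast)

lemma cls_Zero:
  assumes O: "X \<in> Ob D" "Y \<in> Ob D"
  shows "cls X Y (Zero D X Y) = ideal X Y"
proof -
  have "Zero D X Y \<uplus> h = h" if "h \<in> ideal X Y" for h
    using ideal_arr[OF that] by (simp add: arr_iff)
  then show ?thesis unfolding mor_class_def by force
qed

lemma cls_eq_ideal_iff:
  assumes f: "arr D X Y f"
  shows "cls X Y f = ideal X Y \<longleftrightarrow> f \<in> ideal X Y"
proof
  show "f \<in> ideal X Y" if "cls X Y f = ideal X Y" using cls_self[OF f] that by simp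
  assume n: "f \<in> ideal X Y"
  have O: "X \<in> Ob D" "Y \<in> Ob D" using arr_Ob[OF f] by auto
  have "f = Zero D X Y \<uplus> f" using f by (simp add: arr_iff)
  then show "cls X Y f = ideal X Y"
    using cls_eqI[of X Y "Zero D X Y" f] n O cls_Zero[OF O] by (simp add: arr_iff)
qed

lemma quotient_sel [simp]:
  "Ob quotient_cat = Ob D" "Idt quotient_cat X = cls X X (Idt D X)" "Zero quotient_cat X Y = ideal X Y"
  by (simp_all add: additive_quotient_def)

lemma arr_quotient: "arr quotient_cat X Y F \<longleftrightarrow> (\<exists>f. arr D X Y f \<and> F = cls X Y f)"
  unfolding arr_def by (auto simp: additive_quotient_def)

lemma arr_quotient_cls: "arr D X Y f \<Longrightarrow> arr quotient_cat X Y (cls X Y f)"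
  unfolding arr_quotient by blast

text \<open>
  Arrows determine their source and target, so the union that defines the composite of two cosets
  ranges over representatives of a single coset.
\<close>

lemma Comp_quotient:
  assumes f: "arr D X Y f" and g: "arr D Y Z g"
  shows "cls Y Z g \<cdot>\<^bsub>quotient_cat\<^esub> cls X Y f = cls X Z (g \<cdot> f)"
proof -
  have *: "cls X' Z' (g' \<cdot> f') = cls X Z (g \<cdot> f)"
    if 1: "f' \<in> cls X Y f" "g' \<in> cls Y Z g" "arr D X' Y' f'" "arr D Y' Z' g'" for X' Y' Z' f' g'
  proof -
    have X: "X' = X" "Z' = Z" using arr_unique cls_arr[OF f 1(1)] cls_arr[OF g 1(2)] 1(3,4) by metis+
    obtain h where h: "h \<in> ideal X Y" "f' = f \<uplus> h" using 1(1) unfolding mor_class_def by blast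
    obtain k where k: "k \<in> ideal Y Z" "g' = g \<uplus> k" using 1(2) unfolding mor_class_def by blast
    note h' = ideal_arr[OF h(1)] and k' = ideal_arr[OF k(1)]
    have "g' \<cdot> f' = g \<cdot> f \<uplus> (g \<cdot> h \<uplus> k \<cdot> (f \<uplus> h))"
      unfolding h(2) k(2) using f g h' k' by (simp add: arr_iff Add_ac)
    moreover have "g \<cdot> h \<uplus> k \<cdot> (f \<uplus> h) \<in> ideal X Z"
      using f g h' k' by (intro ideal_Add ideal_Comp(1)[OF h(1)] ideal_Comp(2)[OF k(1)]) (simp_all add: arr_iff)
    ultimately show ?thesis unfolding X using cls_eqI[OF arr_Comp[OF f g]] by simp
  qed
  have "{cls X' Z' (g' \<cdot> f') | X' Y' Z' f' g'.
      f' \<in> cls X Y f \<and> g' \<in> cls Y Z g \<and> arr D X' Y' f' \<and> arr D Y' Z' g'} = {cls X Z (g \<cdot> f)}"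
    using * cls_self[OF f] cls_self[OF g] f g by blast
  then show ?thesis unfolding additive_quotient_def by simp
qed

lemma Add_quotient:
  assumes f: "arr D X Y f" and g: "arr D X Y g"
  shows "cls X Y f \<uplus>\<^bsub>quotient_cat\<^esub> cls X Y g = cls X Y (f \<uplus> g)"
proof -
  have "{f' \<uplus> g' | f' g'. f' \<in> cls X Y f \<and> g' \<in> cls X Y g} = cls X Y (f \<uplus> g)"
  proof safe
    fix f' g' assume "f' \<in> cls X Y f" "g' \<in> cls X Y g"
    then obtain h k where h: "h \<in> ideal X Y" "f' = f \<uplus> h" and k: "k \<in> ideal X Y" "g' = g \<uplus> k"
      unfolding mor_class_def by blast
    have "f' \<uplus> g' = (f \<uplus> g) \<uplus> (h \<uplus> k)"
      unfolding h(2) k(2) using f g ideal_arr[OF h(1)] ideal_arr[OF k(1)] by (simp add: arr_iff Add_ac)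
    then show "f' \<uplus> g' \<in> cls X Y (f \<uplus> g)"
      unfolding mor_class_def using ideal_Add[OF h(1) k(1)] by blast
  next
    fix x assume "x \<in> cls X Y (f \<uplus> g)"
    then obtain h where h: "h \<in> ideal X Y" "x = f \<uplus> g \<uplus> h" unfolding mor_class_def by blast
    have "x = f \<uplus> (g \<uplus> h)" unfolding h(2) using f g ideal_arr[OF h(1)] by (simp add: arr_iff Add_assoc)
    moreover have "g \<uplus> h \<in> cls X Y g" unfolding mor_class_def using h(1) by blast
    ultimately show "\<exists>f' g'. x = f' \<uplus> g' \<and> f' \<in> cls X Y f \<and> g' \<in> cls X Y g"
      using cls_self[OF f] by blast
  qed
  then show ?thesis unfolding additive_quotient_def by simp
qed

lemma preadditive_quotient: "preadditive_category quotient_cat"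
proof (rule preadditive_category.intro)
  show "X = X' \<and> Y = Y'" if F: "arr quotient_cat X Y F" "arr quotient_cat X' Y' F" for X Y X' Y' F
  proof -
    obtain f f' where f: "arr D X Y f" "F = cls X Y f" "arr D X' Y' f'" "F = cls X' Y' f'"
      using F unfolding arr_quotient by blast
    then have "arr D X' Y' f" using cls_self[OF f(1)] cls_arr[OF f(3)] by simp
    then show ?thesis using f(1) arr_unique by blast
  qed
  show "arr quotient_cat X X (Idt quotient_cat X)" if "X \<in> Ob quotient_cat" for X
    using that arr_quotient_cls[OF arr_Idt] by simp
  show "arr quotient_cat X Z (G \<cdot>\<^bsub>quotient_cat\<^esub> F)" if FG: "arr quotient_cat X Y F" "arr quotient_cat Y Z G"
    for X Y Z F G
  proof -
    obtain f g where f: "arr D X Y f" "F = cls X Y f" "arr D Y Z g" "G = cls Y Z g"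
      using FG unfolding arr_quotient by blast
    then show ?thesis using arr_quotient_cls[OF arr_Comp[OF f(1,3)]] Comp_quotient by simp
  qed
  show "(H \<cdot>\<^bsub>quotient_cat\<^esub> G) \<cdot>\<^bsub>quotient_cat\<^esub> F = H \<cdot>\<^bsub>quotient_cat\<^esub> (G \<cdot>\<^bsub>quotient_cat\<^esub> F)"
    if FGH: "arr quotient_cat T X F" "arr quotient_cat X Y G" "arr quotient_cat Y Z H" for T X Y Z F G H
  proof -
    obtain f g h where f: "arr D T X f" "F = cls T X f" "arr D X Y g" "G = cls X Y g"
      "arr D Y Z h" "H = cls Y Z h"
      using FGH unfolding arr_quotient by blast
    then show ?thesis
      using Comp_quotient arr_Comp[OF f(1,3)] arr_Comp[OF f(3,5)] Comp_assoc[OF f(1,3,5)] by simp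
  qed
  show "Idt quotient_cat Y \<cdot>\<^bsub>quotient_cat\<^esub> F = F" "F \<cdot>\<^bsub>quotient_cat\<^esub> Idt quotient_cat X = F"
    if F: "arr quotient_cat X Y F" for X Y F
  proof -
    obtain f where f: "arr D X Y f" "F = cls X Y f" using F unfolding arr_quotient by blast
    have O: "X \<in> Ob D" "Y \<in> Ob D" using arr_Ob[OF f(1)] by auto
    show "Idt quotient_cat Y \<cdot>\<^bsub>quotient_cat\<^esub> F = F" "F \<cdot>\<^bsub>quotient_cat\<^esub> Idt quotient_cat X = F"
      using Comp_quotient[OF f(1) arr_Idt[OF O(2)]] Comp_quotient[OF arr_Idt[OF O(1)] f(1)] f
      by (simp_all add: arr_iff)
  qed
  show "comm_group (hom_group quotient_cat X Y)" if O: "X \<in> Ob quotient_cat" "Y \<in> Ob quotient_cat" for X Y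
  proof -
    have car: "F \<in> carrier (hom_group quotient_cat X Y) \<longleftrightarrow> (\<exists>f. arr D X Y f \<and> F = cls X Y f)" for F
      using arr_quotient[of X Y F] O unfolding arr_def hom_group_def by auto
    have sel: "mult (hom_group quotient_cat X Y) = Add quotient_cat"
      "one (hom_group quotient_cat X Y) = cls X Y (Zero D X Y)"
      using O cls_Zero by (simp_all add: hom_group_def)
    have Z: "arr D X Y (Zero D X Y)" using O by (simp add: arr_iff)
    have A: "arr D X Y (f \<uplus> g)" if "arr D X Y f" "arr D X Y g" for f g using that by (simp add: arr_iff)
    have N: "arr D X Y (neg f)" if "arr D X Y f" for f using that by (simp add: arr_iff)
    show ?thesis
    proof (rule comm_groupI, unfold car sel)
      fix F assume "\<exists>f. arr D X Y f \<and> F = cls X Y f"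
      then obtain f where f: "arr D X Y f" "F = cls X Y f" by blast
      show "cls X Y (Zero D X Y) \<uplus>\<^bsub>quotient_cat\<^esub> F = F"
        using Add_quotient[OF Z f(1)] f by (simp add: arr_iff)
      have "cls X Y (neg f) \<uplus>\<^bsub>quotient_cat\<^esub> F = cls X Y (Zero D X Y)"
        using Add_quotient[OF N f(1)] f by (simp add: arr_iff)
      then show "\<exists>G\<in>carrier (hom_group quotient_cat X Y). G \<uplus>\<^bsub>quotient_cat\<^esub> F = cls X Y (Zero D X Y)"
        using car N[OF f(1)] by blast
      fix G assume "\<exists>f. arr D X Y f \<and> G = cls X Y f"
      then obtain g where g: "arr D X Y g" "G = cls X Y g" by blast
      show "\<exists>f. arr D X Y f \<and> F \<uplus>\<^bsub>quotient_cat\<^esub> G = cls X Y f"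
        using Add_quotient[OF f(1) g(1)] f g A by blast
      show "F \<uplus>\<^bsub>quotient_cat\<^esub> G = G \<uplus>\<^bsub>quotient_cat\<^esub> F"
        using Add_quotient[OF f(1) g(1)] Add_quotient[OF g(1) f(1)] Add_commute[of f g] f g
        by (simp add: arr_iff)
      fix H assume "\<exists>f. arr D X Y f \<and> H = cls X Y f"
      then obtain h where h: "arr D X Y h" "H = cls X Y h" by blast
      show "F \<uplus>\<^bsub>quotient_cat\<^esub> G \<uplus>\<^bsub>quotient_cat\<^esub> H = F \<uplus>\<^bsub>quotient_cat\<^esub> (G \<uplus>\<^bsub>quotient_cat\<^esub> H)"
        using Add_quotient[OF f(1) g(1)] Add_quotient[OF g(1) h(1)] Add_quotient[OF A[OF f(1) g(1)] h(1)]
          Add_quotient[OF f(1) A[OF g(1) h(1)]] Add_assoc[of f g h] f g h by (simp add: arr_iff)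
    next
      show "\<exists>f. arr D X Y f \<and> cls X Y (Zero D X Y) = cls X Y f" using Z by blast
    qed
  qed
  show "(G \<uplus>\<^bsub>quotient_cat\<^esub> H) \<cdot>\<^bsub>quotient_cat\<^esub> F = (G \<cdot>\<^bsub>quotient_cat\<^esub> F) \<uplus>\<^bsub>quotient_cat\<^esub> (H \<cdot>\<^bsub>quotient_cat\<^esub> F)"
    if FGH: "arr quotient_cat X Y F" "arr quotient_cat Y Z G" "arr quotient_cat Y Z H" for X Y Z F G H
  proof -
    obtain f g h where f: "arr D X Y f" "F = cls X Y f" "arr D Y Z g" "G = cls Y Z g"
      "arr D Y Z h" "H = cls Y Z h"
      using FGH unfolding arr_quotient by blast
    have "arr D Y Z (g \<uplus> h)" using f by (simp add: arr_iff)
    then show ?thesis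
      using Comp_quotient Add_quotient f arr_Comp[OF f(1,3)] arr_Comp[OF f(1,5)] Comp_Add_left[OF f(1,3,5)]
      by simp
  qed
  show "H \<cdot>\<^bsub>quotient_cat\<^esub> (F \<uplus>\<^bsub>quotient_cat\<^esub> G) = (H \<cdot>\<^bsub>quotient_cat\<^esub> F) \<uplus>\<^bsub>quotient_cat\<^esub> (H \<cdot>\<^bsub>quotient_cat\<^esub> G)"
    if FGH: "arr quotient_cat X Y F" "arr quotient_cat X Y G" "arr quotient_cat Y Z H" for X Y Z F G H
  proof -
    obtain f g h where f: "arr D X Y f" "F = cls X Y f" "arr D X Y g" "G = cls X Y g"
      "arr D Y Z h" "H = cls Y Z h"
      using FGH unfolding arr_quotient by blast
    have "arr D X Y (f \<uplus> g)" using f by (simp add: arr_iff)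
    then show ?thesis
      using Comp_quotient Add_quotient f arr_Comp[OF f(1,5)] arr_Comp[OF f(3,5)] Comp_Add_right[OF f(1,3,5)]
      by simp
  qed
qed

lemma additive_quotient_additive: "additive_category quotient_cat"
proof -
  interpret Q: preadditive_category quotient_cat by (rule preadditive_quotient)
  show ?thesis
  proof
    obtain z where z: "is_zero_object D z" using zero_object_exists by blast
    have zO: "z \<in> Ob D" using z unfolding is_zero_object_def by simp
    have "\<exists>!F. arr quotient_cat X z F" "\<exists>!F. arr quotient_cat z X F" if "X \<in> Ob D" for X
    proof -
      have "\<exists>!f. arr D X z f" "\<exists>!f. arr D z X f" using z that unfolding is_zero_object_def by simp_all
      then show "\<exists>!F. arr quotient_cat X z F" "\<exists>!F. arr quotient_cat z X F"
        unfolding arr_quotient by metis+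
    qed
    then have "is_zero_object quotient_cat z" using zO unfolding is_zero_object_def by simp
    then show "\<exists>z. is_zero_object quotient_cat z" by blast
    show "\<exists>S. is_direct_sum quotient_cat A B S" if AB: "A \<in> Ob quotient_cat" "B \<in> Ob quotient_cat" for A B
    proof -
      obtain S i1 i2 p1 p2 where S: "is_biproduct D A B S i1 i2 p1 p2"
        using direct_sum_exists AB unfolding is_direct_sum_def by fastforce
      note b = biproductD[OF S]
      have "is_biproduct quotient_cat A B S (cls A S i1) (cls B S i2) (cls S A p1) (cls S B p2)"
        unfolding is_biproduct_def
        using b AB arr_quotient_cls Comp_quotient[OF b(1,3)] Comp_quotient[OF b(1,4)]
          Comp_quotient[OF b(2,3)] Comp_quotient[OF b(2,4)] Comp_quotient[OF b(3,1)] Comp_quotient[OF b(4,2)]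
          cls_Zero Add_quotient[OF arr_Comp[OF b(3,1)] arr_Comp[OF b(4,2)]]
        by simp
      then show ?thesis unfolding is_direct_sum_def by blast
    qed
  qed
qed

lemma quotient_epi_cancel:
  assumes epi: "is_epi quotient_cat X Y (cls X Y f)" and f: "arr D X Y f"
    and t: "arr D Y T t" "t \<cdot> f \<in> ideal X T"
  shows "t \<in> ideal Y T"
proof -
  have O: "X \<in> Ob D" "Y \<in> Ob D" "T \<in> Ob D" using arr_Ob[OF f] arr_Ob[OF t(1)] by auto
  have Z: "arr D Y T (Zero D Y T)" using O by (simp add: arr_iff)
  have "cls Y T t \<cdot>\<^bsub>quotient_cat\<^esub> cls X Y f = cls Y T (Zero D Y T) \<cdot>\<^bsub>quotient_cat\<^esub> cls X Y f"
    using Comp_quotient[OF f t(1)] Comp_quotient[OF f Z] cls_eq_ideal_iff[OF arr_Comp[OF f t(1)]] t(2)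
      cls_Zero O f by (simp add: arr_iff)
  then have "cls Y T t = cls Y T (Zero D Y T)"
    using epi arr_quotient_cls[OF t(1)] arr_quotient_cls[OF Z] unfolding is_epi_def by blast
  then show ?thesis using cls_eq_ideal_iff[OF t(1)] cls_Zero[OF O(2,3)] by simp
qed

text \<open>
  Uniqueness is only asked against zero: two factorizations differ by an arrow whose composite with
  \<open>q\<close> is in the ideal.
\<close>

lemma quotient_is_cokernelI:
  assumes f: "arr D X Y f" and q: "arr D Y Q q" and qf: "q \<cdot> f \<in> ideal X Q"
    and ex: "\<And>T t. \<lbrakk>arr D Y T t; t \<cdot> f \<in> ideal X T\<rbrakk> \<Longrightarrow> \<exists>u h. arr D Q T u \<and> h \<in> ideal Y T \<and> t = u \<cdot> q \<uplus> h"
    and un: "\<And>T u. \<lbrakk>arr D Q T u; u \<cdot> q \<in> ideal Y T\<rbrakk> \<Longrightarrow> u \<in> ideal Q T"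
  shows "is_cokernel quotient_cat X Y Q (cls X Y f) (cls Y Q q)"
proof (rule preadditive_category.is_cokernelI[OF preadditive_quotient])
  show "arr quotient_cat X Y (cls X Y f)" "arr quotient_cat Y Q (cls Y Q q)"
    using f q arr_quotient_cls by auto
  show "cls Y Q q \<cdot>\<^bsub>quotient_cat\<^esub> cls X Y f = Zero quotient_cat X Q"
    using Comp_quotient[OF f q] cls_eq_ideal_iff[OF arr_Comp[OF f q]] qf by simp
next
  fix T F assume F: "arr quotient_cat Y T F" "F \<cdot>\<^bsub>quotient_cat\<^esub> cls X Y f = Zero quotient_cat X T"
  then obtain t where t: "arr D Y T t" "F = cls Y T t" unfolding arr_quotient by blast
  have "t \<cdot> f \<in> ideal X T"
    using F(2) Comp_quotient[OF f t(1)] cls_eq_ideal_iff[OF arr_Comp[OF f t(1)]] t(2) by simp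
  then obtain u h where u: "arr D Q T u" "h \<in> ideal Y T" "t = u \<cdot> q \<uplus> h" using ex t(1) by blast
  have "cls Q T u \<cdot>\<^bsub>quotient_cat\<^esub> cls Y Q q = F"
    using Comp_quotient[OF q u(1)] cls_eqI[OF arr_Comp[OF q u(1)] u(2)] u(3) t(2) by simp
  then show "\<exists>G. arr quotient_cat Q T G \<and> G \<cdot>\<^bsub>quotient_cat\<^esub> cls Y Q q = F"
    using arr_quotient_cls[OF u(1)] by blast
next
  fix T F G assume F: "arr quotient_cat Q T F" "arr quotient_cat Q T G"
    "F \<cdot>\<^bsub>quotient_cat\<^esub> cls Y Q q = G \<cdot>\<^bsub>quotient_cat\<^esub> cls Y Q q"
  then obtain u v where u: "arr D Q T u" "F = cls Q T u" and v: "arr D Q T v" "G = cls Q T v"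
    unfolding arr_quotient by blast
  have "cls Y T (u \<cdot> q) = cls Y T (v \<cdot> q)"
    using F(3) Comp_quotient[OF q u(1)] Comp_quotient[OF q v(1)] u v by simp
  then obtain h where h: "h \<in> ideal Y T" "u \<cdot> q = v \<cdot> q \<uplus> h"
    using cls_eq_iff[OF arr_Comp[OF q u(1)] arr_Comp[OF q v(1)]] by blast
  obtain r where r: "arr D Q T r" "u = v \<uplus> r" using difference_exists[OF u(1) v(1)] by blast
  have h': "arr D Y T h" using ideal_arr[OF h(1)] .
  have "v \<cdot> q \<uplus> r \<cdot> q = v \<cdot> q \<uplus> h" using h(2) unfolding r(2) using q v(1) r(1) by (simp add: arr_iff)
  then have "r \<cdot> q = h"
    using Add_cancel[of "v \<cdot> q" "r \<cdot> q" h] q v(1) r(1) h' by (simp add: arr_iff)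
  then have "r \<in> ideal Q T" using un[OF r(1)] h(1) by simp
  then show "F = G" unfolding u v r(2) using cls_eqI[OF v(1)] by blast
qed

end

lemma factoring_through_op: "factoring_through (op_cat D) W X Y = factoring_through D W Y X"
  unfolding factoring_through_def by auto

lemma mor_class_op: "mor_class (op_cat D) W X Y = mor_class D W Y X"
  unfolding mor_class_def factoring_through_op by simp

lemma additive_quotient_op: "additive_quotient (op_cat D) W = op_cat (additive_quotient D W)"
proof -
  have "{mor_class D W Z X (f \<cdot>\<^bsub>D\<^esub> g) | X Y Z f g. f \<in> F \<and> g \<in> G \<and> arr D Y X f \<and> arr D Z Y g}
      = {mor_class D W X Z (g \<cdot>\<^bsub>D\<^esub> f) | X Y Z f g. f \<in> G \<and> g \<in> F \<and> arr D X Y f \<and> arr D Y Z g}" for F G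
    by blast
  then show ?thesis
    by (simp add: additive_quotient_def op_cat_def[of "additive_quotient D W"] mor_class_op
        factoring_through_op additive_quotient_def fun_eq_iff)
qed

lemma full_subcategory_op: "full_subcategory (op_cat C) S = op_cat (full_subcategory C S)"
  by (simp add: full_subcategory_def op_cat_def)

text \<open>
  Passing to the opposite category exchanges \<open>U\<close> with \<open>V\<close> and \<open>B\<^sup>+\<close> with \<open>B\<^sup>-\<close>, and keeps the core.
\<close>

lemma heart_op: "heart (op_cat C) (E\<inverse>) V U = op_cat (heart C E U V)"
  unfolding heart_def B_plus_op B_minus_op full_subcategory_op additive_quotient_op
  by (simp add: Int_commute)

lemma full_subcategory_sel:
  "Ob (full_subcategory C S) = S" "Hom (full_subcategory C S) = Hom C" "Idt (full_subcategory C S) = Idt C"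
  "Comp (full_subcategory C S) = Comp C" "Add (full_subcategory C S) = Add C"
  "Zero (full_subcategory C S) = Zero C"
  by (simp_all add: full_subcategory_def)

lemma arr_full_subcategory:
  "S \<subseteq> Ob C \<Longrightarrow> arr (full_subcategory C S) X Y f \<longleftrightarrow> X \<in> S \<and> Y \<in> S \<and> arr C X Y f"
  unfolding arr_def full_subcategory_def by auto

lemma is_zero_object_full_subcategory:
  assumes S: "S \<subseteq> Ob C" and z: "z \<in> S" "is_zero_object C z"
  shows "is_zero_object (full_subcategory C S) z"
proof -
  have "(\<exists>!f. arr (full_subcategory C S) X z f) \<and> (\<exists>!f. arr (full_subcategory C S) z X f)"
    if X: "X \<in> S" for X
  proof -
    have "(\<exists>!f. arr C X z f) \<and> (\<exists>!f. arr C z X f)"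
      using z(2) X S unfolding is_zero_object_def by blast
    then show ?thesis unfolding arr_full_subcategory[OF S] using X z(1) by simp
  qed
  then show ?thesis
    unfolding is_zero_object_def full_subcategory_sel using z(1) by simp
qed

lemma is_direct_sum_full_subcategory:
  assumes "S \<subseteq> Ob C" "A \<in> S" "B \<in> S" "X \<in> S" "is_direct_sum C A B X"
  shows "is_direct_sum (full_subcategory C S) A B X"
  using assms(2-5)
  unfolding is_direct_sum_def is_biproduct_def full_subcategory_sel arr_full_subcategory[OF assms(1)] by simp

lemma is_additive_subcategory_full_subcategory:
  assumes S: "S \<subseteq> Ob C" and W: "is_additive_subcategory C W" "W \<subseteq> S"
  shows "is_additive_subcategory (full_subcategory C S) W"
proof -
  obtain z where z: "z \<in> W" "is_zero_object C z"
    using W(1) unfolding is_additive_subcategory_def by blast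
  have "\<exists>X\<in>W. is_direct_sum (full_subcategory C S) A B X" if AB: "A \<in> W" "B \<in> W" for A B
  proof -
    obtain X where "X \<in> W" "is_direct_sum C A B X"
      using W(1) AB unfolding is_additive_subcategory_def by blast
    then show ?thesis using is_direct_sum_full_subcategory[OF S] AB W(2) by (meson subsetD)
  qed
  moreover have "is_zero_object (full_subcategory C S) z"
    using is_zero_object_full_subcategory[OF S _ z(2)] z(1) W(2) by blast
  ultimately show ?thesis
    unfolding is_additive_subcategory_def full_subcategory_sel using W(2) z(1) by blast
qed

lemma full_subcategory_additive:
  fixes C :: "('o, 'm) cat"
  assumes "additive_category C" and S: "is_additive_subcategory C S"
  shows "additive_category (full_subcategory C S)"
proof -
  interpret additive_category C by fact
  have SO: "S \<subseteq> Ob C" using S unfolding is_additive_subcategory_def by simp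
  note arr' = arr_full_subcategory[OF SO]
  have hom: "hom_group (full_subcategory C S) X Y = hom_group C X Y" for X Y
    by (simp add: hom_group_def full_subcategory_sel)
  interpret F: preadditive_category "full_subcategory C S"
    using SO
    by (intro preadditive_category.intro)
      (auto simp: full_subcategory_sel arr' hom intro: arr_Idt arr_Comp Comp_assoc Comp_Idt_left
        Comp_Idt_right comm_group_hom Comp_Add_left Comp_Add_right dest: arr_unique)
  show ?thesis
  proof
    show "\<exists>z. is_zero_object (full_subcategory C S) z"
      using is_zero_object_full_subcategory[OF SO] S unfolding is_additive_subcategory_def by blast
    show "\<exists>X. is_direct_sum (full_subcategory C S) A B X"
      if AB: "A \<in> Ob (full_subcategory C S)" "B \<in> Ob (full_subcategory C S)" for A B
      using is_additive_subcategory_full_subcategory[OF SO S] AB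
      unfolding is_additive_subcategory_def full_subcategory_sel by blast
  qed
qed

section \<open>The heart is abelian\<close>

text \<open>
  The record type without further fields is the one for which \<open>heart\<close> is defined.
\<close>

locale cotorsion_heart = cotorsion_pair C E U V
  for C :: "('o, 'm) cat" (structure) and E U V
begin

abbreviation heart_objects :: "'o set" where
  "heart_objects \<equiv> B_plus C E U V \<inter> B_minus C E U V"

lemma heart_objects_subset: "heart_objects \<subseteq> Ob C"
  unfolding B_plus_def by blast

lemma heart_objects_additive: "is_additive_subcategory C heart_objects"
proof -
  note O = heart_objects_subset
  obtain z where "is_zero_object C z" using zero_object_exists by blast
  then have "\<exists>z\<in>heart_objects. is_zero_object C z"
    using zero_object_in core_subset_B_plus core_subset_B_minus by blast
  moreover have "\<exists>S\<in>heart_objects. is_direct_sum C A B S"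
    if AB: "A \<in> heart_objects" "B \<in> heart_objects" for A B
  proof -
    obtain S i1 i2 p1 p2 where "is_biproduct C A B S i1 i2 p1 p2"
      using direct_sum_exists[of A B] AB O unfolding is_direct_sum_def by blast
    then show ?thesis using B_plus_biproduct B_minus_biproduct AB unfolding is_direct_sum_def by blast
  qed
  ultimately show ?thesis using O unfolding is_additive_subcategory_def by blast
qed

abbreviation H :: "('o, 'm) cat" where
  "H \<equiv> full_subcategory C heart_objects"

lemma arr_H: "arr H X Y f \<longleftrightarrow> X \<in> heart_objects \<and> Y \<in> heart_objects \<and> arr C X Y f"
  by (rule arr_full_subcategory[OF heart_objects_subset])

lemma core_subset_heart: "U \<inter> V \<subseteq> heart_objects"
  using core_subset_B_plus core_subset_B_minus by blast

lemma heart_quotient: "additive_quotient_category H (U \<inter> V)"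
proof -
  interpret H: additive_category H
    using full_subcategory_additive[OF additive_category_axioms heart_objects_additive] .
  have "is_additive_subcategory H (U \<inter> V)"
    by (rule is_additive_subcategory_full_subcategory[OF heart_objects_subset core_additive core_subset_heart])
  then show ?thesis by unfold_locales
qed

text \<open>
  Arrows that factor through the core in \<open>C\<close> already do so inside the full subcategory, because the
  core is contained in it.
\<close>

lemma ideal_H:
  assumes "X \<in> heart_objects" "Y \<in> heart_objects"
  shows "factoring_through H (U \<inter> V) X Y = factoring_through C (U \<inter> V) X Y"
  unfolding factoring_through_def arr_H full_subcategory_sel using assms core_subset_heart by blast

sublocale quot: additive_quotient_category H "U \<inter> V"
  by (rule heart_quotient)

lemma heart_eq: "heart C E U V = quot.quotient_cat"
  unfolding heart_def ..

lemma heart_cokernel_exists: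
  assumes "arr (heart C E U V) A B F"
  shows "\<exists>Q q. is_cokernel (heart C E U V) A B Q F q"
proof -
  obtain f where f: "arr H A B f" "F = quot.cls A B f"
    using assms unfolding heart_eq quot.arr_quotient by blast
  have AB: "A \<in> heart_objects" "B \<in> heart_objects" "arr C A B f" using f(1) unfolding arr_H by auto
  obtain Q q where Q: "Q \<in> heart_objects" "arr C B Q q" "null A Q (q \<cdot> f)"
    "\<And>Y t. Y \<in> B_plus C E U V \<Longrightarrow> arr C B Y t \<Longrightarrow> null A Y (t \<cdot> f) \<Longrightarrow> \<exists>u. arr C Q Y u \<and> u \<cdot> q = t"
    "\<And>Y u. Y \<in> B_plus C E U V \<Longrightarrow> arr C Q Y u \<Longrightarrow> null B Y (u \<cdot> q) \<Longrightarrow> null Q Y u"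
    using null_cokernel_exists[OF _ _ AB(3)] AB(1,2) by blast
  have "is_cokernel quot.quotient_cat A B Q (quot.cls A B f) (quot.cls B Q q)"
  proof (rule quot.quotient_is_cokernelI[OF f(1)], unfold full_subcategory_sel)
    show "arr H B Q q" "q \<cdot> f \<in> quot.ideal A Q" using AB Q(1-3) arr_H ideal_H by auto
    show "\<exists>u h. arr H Q T u \<and> h \<in> quot.ideal B T \<and> t = u \<cdot> q \<uplus> h"
      if t: "arr H B T t" "t \<cdot> f \<in> quot.ideal A T" for T t
    proof -
      have T: "T \<in> heart_objects" "arr C B T t" using t(1) unfolding arr_H by auto
      then obtain u where u: "arr C Q T u" "u \<cdot> q = t" using Q(4)[of T t] t(2) AB ideal_H by auto
      have "Zero C B T \<in> quot.ideal B T" using quot.ideal_Zero[of B T] T AB by (simp add: full_subcategory_sel)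
      moreover have "t = u \<cdot> q \<uplus> Zero C B T" using u T(2) by (simp add: arr_iff)
      ultimately show ?thesis using u(1) Q(1) T(1) arr_H by blast
    qed
    show "u \<in> quot.ideal Q T" if "arr H Q T u" "u \<cdot> q \<in> quot.ideal B T" for T u
      using that Q(5)[of T u] Q(1) AB arr_H ideal_H by auto
  qed
  then show ?thesis unfolding heart_eq f(2) by blast
qed

lemma heart_epi_is_cokernel:
  assumes "is_epi (heart C E U V) A B F"
  shows "\<exists>K k. is_cokernel (heart C E U V) K A B k F"
proof -
  obtain f where f: "arr H A B f" "F = quot.cls A B f"
    using assms unfolding heart_eq is_epi_def quot.arr_quotient by blast
  have AB: "A \<in> heart_objects" "B \<in> heart_objects" "arr C A B f" using f(1) unfolding arr_H by auto
  have epi: "null B Y t" if "Y \<in> heart_objects" "arr C B Y t" "null A Y (t \<cdot> f)" for Y t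
    using quot.quotient_epi_cancel[of A B f Y t] assms f that AB ideal_H arr_H
    unfolding heart_eq full_subcategory_sel by auto
  obtain K k where K: "K \<in> heart_objects" "arr C K A k" "null K B (f \<cdot> k)"
    "\<And>Y g. arr C A Y g \<Longrightarrow> null K Y (g \<cdot> k) \<Longrightarrow> \<exists>u n. arr C B Y u \<and> null A Y n \<and> g = u \<cdot> f \<uplus> n"
    using null_epi_is_cokernel[OF AB epi] by blast
  have kH: "arr H K A k" using K(1,2) AB arr_H by blast
  have "is_cokernel quot.quotient_cat K A B (quot.cls K A k) (quot.cls A B f)"
  proof (rule quot.quotient_is_cokernelI[OF kH f(1)], unfold full_subcategory_sel)
    show "f \<cdot> k \<in> quot.ideal K B" using AB K(1,3) ideal_H by auto
    show "\<exists>u h. arr H B T u \<and> h \<in> quot.ideal A T \<and> t = u \<cdot> f \<uplus> h"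
      if t: "arr H A T t" "t \<cdot> k \<in> quot.ideal K T" for T t
    proof -
      have T: "T \<in> heart_objects" "arr C A T t" using t(1) unfolding arr_H by auto
      then obtain u n where "arr C B T u" "null A T n" "t = u \<cdot> f \<uplus> n"
        using K(4)[of T t] t(2) K(1) ideal_H by auto
      then show ?thesis using T AB arr_H ideal_H by blast
    qed
    show "u \<in> quot.ideal B T" if "arr H B T u" "u \<cdot> f \<in> quot.ideal A T" for T u
      using that epi[of T u] AB arr_H ideal_H by auto
  qed
  then show ?thesis unfolding heart_eq f(2) by blast
qed

end

theorem theorem4p3:
  fixes C :: "('o, 'm) cat"
    and E :: "('m \<times> 'm) set"
    and U V :: "'o set"
  assumes "exact_category C E"
    and "krull_schmidt_category C"
    and "enough_projectives C E"
    and "enough_injectives C E"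
    and "cotorsion_pair C E U V"
  shows "abelian_category (heart C E U V)"
proof -
  interpret cotorsion_heart C E U V
    using assms(5) by (rule cotorsion_heart.intro)
  interpret dual: cotorsion_heart "op_cat C" "E\<inverse>" V U
    using cotorsion_pair_op by (rule cotorsion_heart.intro)
  interpret heart: additive_category "heart C E U V"
    unfolding heart_eq by (rule quot.additive_quotient_additive)
  show ?thesis
  proof
    show "\<exists>K k. is_kernel (heart C E U V) K X Y k f" if "arr (heart C E U V) X Y f" for X Y f
      using dual.heart_cokernel_exists[of Y X f] that unfolding heart_op by simp
    show "\<exists>Z g. is_kernel (heart C E U V) X Y Z f g" if "is_mono (heart C E U V) X Y f" for X Y f
      using dual.heart_epi_is_cokernel[of Y X f] that unfolding heart_op by simp
  qed (fact heart_cokernel_exists heart_epi_is_cokernel)+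
qed

end
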